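(* Let $K\subset\mathbb{R}^d$ ($d\geq 1$) be a closed convex cone with non-empty interior, let $v$ be a fixed vector in the interior of $K$, and let $\mu$ be a probability measure on $\mathbb{R}^d$ such that: (i) the support of $\mu$ is not included in any linear hyperplane of $\mathbb{R}^d$; (ii) there exist a point $x^*\in K^*$ and an open neighborhood $V$ of $x^*$ in $\mathbb{R}^d$ such that $L_\mu(x)<\infty$ for all $x\in V$, and $x^*$ is a minimum point of $L_\mu$ restricted to $K^*\cap V$. Then there exists a constant $\delta\geq 0$ such that, for all $x\in K_\delta$, $$\lim_{n\to\infty}\mathbb{P}^x_\mu[\tau_K>n]^{1/n}=L_\mu(x^* ).$$
   Context: $\langle\cdot,\cdot\rangle$ is the standard inner product on $\mathbb{R}^d$. The dual cone of $K$ is $K^*=\{z\in\mathbb{R}^d:\langle x,z\rangle\geq 0\ \forall x\in K\}$. The Laplace transform of $\mu$ is $L_\mu(x)=\int_{\mathbb{R}^d}e^{\langle x,y\rangle}\mu(dy)\in(0,\infty]$. For $\delta\in\mathbb{R}$, $K_\delta=K+\delta v$. Under $\mathbb{P}^x_\mu$, $(S_n)_{n\geq 0}$ is a random walk on $\mathbb{R}^d$ with $S_0=x$ whose increments $S_{n+1}-S_n$ are independent with common distribution $\mu$. The exit time is $\tau_K=\inf\{n\geq 1:S_n\notin K\}$ (with $\inf\emptyset=\infty$). *)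

theory Defs
  imports "HOL-Probability.Probability" "HOL-Library.Extended_Nat"
begin

definition dual_cone :: "'a::real_inner set \<Rightarrow> 'a set" where
  "dual_cone K = {z. \<forall>x\<in>K. x \<bullet> z \<ge> 0}"

definition shifted_cone :: "'a::real_vector set \<Rightarrow> 'a \<Rightarrow> real \<Rightarrow> 'a set" where
  "shifted_cone K v \<delta> = (\<lambda>k. k + \<delta> *\<^sub>R v) ` K"

definition measure_support :: "'a::topological_space measure \<Rightarrow> 'a set" where
  "measure_support \<mu> = {x. \<forall>U. open U \<and> x \<in> U \<longrightarrow> emeasure \<mu> U > 0}"

definition laplace_transform :: "'a::euclidean_space measure \<Rightarrow> 'a \<Rightarrow> ennreal" where
  "laplace_transform \<mu> x = (\<integral>\<^sup>+ y. ennreal (exp (x \<bullet> y)) \<partial>\<mu>)"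

text \<open>
  The law, on path space, of the random walk started at \<open>x\<close> with i.i.d. increments
  distributed according to \<open>\<mu>\<close>: the image of the product measure of the increments
  \<open>\<xi> 0, \<xi> 1, \<dots>\<close> under the partial-sum map.
\<close>

definition random_walk_law ::
    "'a::euclidean_space measure \<Rightarrow> 'a \<Rightarrow> (nat \<Rightarrow> 'a) measure" where
  "random_walk_law \<mu> x =
     distr (\<Pi>\<^sub>M i\<in>(UNIV::nat set). \<mu>) (\<Pi>\<^sub>M i\<in>(UNIV::nat set). borel)
       (\<lambda>\<xi> n. x + (\<Sum>i<n. \<xi> i))"

text \<open>The infimum is taken in \<^typ>\<open>enat\<close>, so it is \<open>\<infinity>\<close> for a path that never leaves \<open>K\<close>.\<close>

definition exit_time :: "'a set \<Rightarrow> (nat \<Rightarrow> 'a) \<Rightarrow> enat" where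
  "exit_time K S = Inf {enat n | n. n \<ge> 1 \<and> S n \<notin> K}"

end

theory Submission
  imports Defs "HOL-Real_Asymp.Real_Asymp"
begin

text \<open>
  Write \<open>L\<close> for the value of the Laplace transform at \<open>x\<^sup>*\<close> and \<open>S\<^sub>n = x + W\<^sub>n\<close> for the walk.

  The upper bound is Markov's inequality: staying in \<open>K\<close> forces \<open>S\<^sub>n \<in> K\<close>, hence
  \<open>\<langle>x\<^sup>*, S\<^sub>n\<rangle> \<ge> 0\<close>, and the expectation of \<open>exp \<langle>x\<^sup>*, S\<^sub>n\<rangle>\<close> is \<open>exp \<langle>x\<^sup>*, x\<rangle> * L ^ n\<close>
  (\<open>prob_stay_le\<close>).

  For the lower bound, replace \<open>\<mu>\<close> by the tilted law \<open>\<nu>\<close> with density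
  \<open>exp \<langle>x\<^sup>*, y\<rangle> / L\<close>, which has mean \<open>m\<close>. Moving from \<open>x\<^sup>*\<close> a little way along a direction that
  remains in the dual cone cannot decrease the Laplace transform, so its derivative \<open>L * \<langle>z, m\<rangle>\<close> along
  such a direction \<open>z\<close> is nonnegative. The directions \<open>z \<in> K\<^sup>*\<close> give \<open>m \<in> K\<close> because \<open>K\<close> is its own
  bidual, and \<open>z = - x\<^sup>*\<close> gives \<open>\<langle>x\<^sup>*, m\<rangle> \<le> 0\<close>
  (\<open>feasible_direction_inner_mean_nonneg\<close>). On the event that \<open>W\<^sub>n\<close> is within \<open>\<eta> * n\<close> of
  \<open>n * m\<close> the density of the tilted path law is therefore at most \<open>exp (\<bar>x\<^sup>*\<bar> * \<eta> * n) / L ^ n\<close>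
  (\<open>tilted_prob_le\<close>), and it suffices that under \<open>\<nu>\<close> the walk stays in \<open>K\<close> and ends that close to
  \<open>n * m\<close> with a probability of at least \<open>exp (- \<eta> * n)\<close>, for every \<open>\<eta> > 0\<close> and all large \<open>n\<close>
  (\<open>eventually_confined\<close>).

  This is not immediate, as \<open>m\<close> may lie on the boundary of \<open>K\<close>. A small proportion \<open>\<alpha>\<close> of the \<open>n\<close> steps
  is spent on moving inwards. Since \<open>\<nu>\<close> lives on no hyperplane, some convex combination \<open>s\<close> of finitely
  many points of its support lies in the interior of \<open>K\<close>, for otherwise a hyperplane separating the
  support from \<open>K\<close> would contain the support (\<open>interior_meets_hull_of_support\<close>). These points can be
  visited in an order that keeps their partial sums close to the multiples of \<open>s\<close>
  (\<open>greedy_walk_close_to_line\<close>). Forcing the first \<open>\<alpha> * n\<close> increments to be near the points of that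
  sequence brings the walk to a depth proportional to \<open>\<alpha> * n\<close> in \<open>K\<close>. It costs a factor
  \<open>p ^ (\<alpha> * n)\<close> with a fixed \<open>p > 0\<close>, so its exponential rate vanishes with \<open>\<alpha>\<close>. The constant
  \<open>\<delta>\<close> only has to absorb the bounded part of the error in this first phase, hence does not depend on
  \<open>\<alpha>\<close>. From then on the drift \<open>m \<in> K\<close> does no harm, and by a Chernoff bound the walk, with
  conditional probability at least one half, deviates from its drift by no more than that depth (\<open>eventually_small_fluctuations\<close>).
\<close>

section \<open>Balls inside a convex cone\<close>

text \<open>
  The radius of a ball contained in \<open>K\<close> measures how deep its centre lies in \<open>K\<close>; depth is
  superadditive because a displacement of norm at most \<open>R + R'\<close> splits, in the ratio of the radii,
  into one for each centre.
\<close>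

lemma cball_add_subset_cone:
  fixes K :: "'a::real_normed_vector set"
  assumes "convex_cone K" "cball a R \<subseteq> K" "cball b R' \<subseteq> K" "R \<ge> 0" "R' \<ge> 0"
  shows "cball (a + b) (R + R') \<subseteq> K"
proof
  fix z assume "z \<in> cball (a + b) (R + R')"
  then have z: "norm (z - (a + b)) \<le> R + R'" by (simp add: dist_norm norm_minus_commute)
  show "z \<in> K"
  proof (cases "R + R' = 0")
    case True
    then have "R = 0" "R' = 0" "z = a + b" using assms(4,5) z by auto
    then show ?thesis using assms by (auto intro!: convex_cone_add)
  next
    case False
    define w where "w = z - (a + b)"
    have pos: "R + R' > 0" using False assms by simp
    have *: "norm ((r / (R + R')) *\<^sub>R w) \<le> r" if "r \<ge> 0" for r
    proof -
      have "r * norm w \<le> r * (R + R')" using z that by (intro mult_left_mono) (auto simp: w_def)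
      then show ?thesis using pos that by (simp add: field_simps)
    qed
    have "a + (R / (R + R')) *\<^sub>R w \<in> cball a R" "b + (R' / (R + R')) *\<^sub>R w \<in> cball b R'"
      using *[OF assms(4)] *[OF assms(5)] by (simp_all only: mem_cball dist_add_cancel dist_norm
          add_diff_cancel_left' norm_minus_commute[of a] norm_minus_commute[of b])
    then have "a + (R / (R + R')) *\<^sub>R w \<in> K" "b + (R' / (R + R')) *\<^sub>R w \<in> K"
      using assms(2,3) by blast+
    then have "(a + (R / (R + R')) *\<^sub>R w) + (b + (R' / (R + R')) *\<^sub>R w) \<in> K"
      by (rule convex_cone_add[OF assms(1)])
    also have "(a + (R / (R + R')) *\<^sub>R w) + (b + (R' / (R + R')) *\<^sub>R w) = a + b + (R / (R + R') + R' / (R + R')) *\<^sub>R w"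
      by (simp only: scaleR_left_distrib ac_simps)
    also have "R / (R + R') + R' / (R + R') = 1"
      using pos by (simp flip: add_divide_distrib)
    finally show ?thesis by (simp add: w_def)
  qed
qed

lemma cball_scaleR_subset_cone:
  fixes K :: "'a::real_normed_vector set"
  assumes "convex_cone K" "cball a R \<subseteq> K" "c \<ge> 0"
  shows "cball (c *\<^sub>R a) (c * R) \<subseteq> K"
proof (cases "c = 0")
  case True
  then show ?thesis using convex_cone_contains_0[OF assms(1)] by simp
next
  case False
  show ?thesis
  proof
    fix z assume z: "z \<in> cball (c *\<^sub>R a) (c * R)"
    have "norm (a - (1 / c) *\<^sub>R z) = (1 / c) * norm (c *\<^sub>R a - z)"
    proof -
      have "a - (1 / c) *\<^sub>R z = (1 / c) *\<^sub>R (c *\<^sub>R a - z)" using False by (simp add: scaleR_diff_right)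
      then show ?thesis using assms(3) by simp
    qed
    also have "\<dots> \<le> (1 / c) * (c * R)" using z assms(3) by (intro mult_left_mono) (auto simp: dist_norm)
    finally have "(1 / c) *\<^sub>R z \<in> K" using False assms(2) by (auto simp: dist_norm)
    then have "c *\<^sub>R ((1 / c) *\<^sub>R z) \<in> K" by (rule convex_cone_scaleR[OF assms(1,3)])
    then show "z \<in> K" using False by simp
  qed
qed

text \<open>
  If \<open>m\<close> were outside \<open>K\<close>, a hyperplane separating it from \<open>K\<close> would, by scaling, have its normal
  in the dual cone while being negative at \<open>m\<close>.
\<close>

lemma bidual_cone_subset:
  fixes K :: "'a::euclidean_space set"
  assumes "closed K" "convex_cone K" "\<And>z. z \<in> dual_cone K \<Longrightarrow> z \<bullet> m \<ge> 0"
  shows "m \<in> K"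
proof (rule ccontr)
  assume "m \<notin> K"
  then obtain a b where ab: "a \<bullet> m < b" "\<And>x. x \<in> K \<Longrightarrow> a \<bullet> x > b"
    using separating_hyperplane_closed_point[of K m] assms(1,2) unfolding convex_cone_def by metis
  have b: "b < 0" using ab(2)[OF convex_cone_contains_0[OF assms(2)]] by simp
  have "a \<bullet> x \<ge> 0" if "x \<in> K" for x
  proof (rule ccontr)
    assume neg: "\<not> a \<bullet> x \<ge> 0"
    have "a \<bullet> ((b / (a \<bullet> x)) *\<^sub>R x) > b"
      using b neg that by (intro ab(2) convex_cone_scaleR[OF assms(2)]) (auto simp: divide_nonpos_nonpos)
    then show False using neg by simp
  qed
  then have "a \<in> dual_cone K" by (simp add: dual_cone_def inner_commute)
  from assms(3)[OF this] ab(1) b show False by simp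
qed

section \<open>Sequences of points shadowing a line\<close>

text \<open>
  Choose each point so that it does not point away from the current error \<open>w\<close>: as \<open>s\<close> is in the convex
  hull, some \<open>y \<in> S\<close> has \<open>w \<bullet> (y - s) \<le> 0\<close>. By Pythagoras the squared error then grows by at most
  \<open>B\<^sup>2\<close> per step, so the error is at most \<open>B * sqrt n\<close>, which the arithmetic-geometric mean
  inequality bounds by \<open>B\<^sup>2 / (4 * \<epsilon>) + \<epsilon> * n\<close>.
\<close>

lemma greedy_walk_close_to_line:
  fixes S :: "'a::real_inner set"
  assumes "finite S" "s \<in> convex hull S" "\<epsilon> > 0"
  shows "\<exists>y D. (\<forall>n. y n \<in> S) \<and> D \<ge> 0 \<and>
    (\<forall>n::nat. norm ((\<Sum>i<n. y i) - real n *\<^sub>R s) \<le> D + \<epsilon> * real n)"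
proof -
  have "\<exists>y\<in>S. w \<bullet> (y - s) \<le> 0" for w
  proof (rule ccontr)
    assume "\<not> ?thesis"
    then have "S \<subseteq> {y. w \<bullet> y > w \<bullet> s}" by (auto simp: inner_diff_right)
    then have "convex hull S \<subseteq> {y. w \<bullet> y > w \<bullet> s}"
      by (rule hull_minimal) (rule convex_halfspace_gt)
    with assms(2) show False by auto
  qed
  then obtain p where p: "\<And>w. p w \<in> S" "\<And>w. w \<bullet> (p w - s) \<le> 0" by metis
  define Y where "Y = rec_nat 0 (\<lambda>n u. u + p (u - real n *\<^sub>R s))"
  have Y: "Y 0 = 0" "\<And>n. Y (Suc n) = Y n + p (Y n - real n *\<^sub>R s)" by (simp_all add: Y_def)
  define y where "y n = p (Y n - real n *\<^sub>R s)" for n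
  have sum_y: "(\<Sum>i<n. y i) = Y n" for n by (induction n) (auto simp: Y y_def)
  define B where "B = Max ((\<lambda>z. norm (z - s)) ` S)"
  have B: "norm (z - s) \<le> B" if "z \<in> S" for z
    using assms(1) that by (auto simp: B_def)
  have B0: "B \<ge> 0" using B[OF p(1)] norm_ge_zero order_trans by blast
  \<comment> \<open>The cross term is nonpositive by the choice of \<open>p\<close>.\<close>
  have sq: "(norm (Y n - real n *\<^sub>R s))\<^sup>2 \<le> real n * B\<^sup>2" for n
  proof (induction n)
    case (Suc n)
    define w where "w = Y n - real n *\<^sub>R s"
    have "Y (Suc n) - real (Suc n) *\<^sub>R s = w + (p w - s)"
      by (simp add: Y w_def algebra_simps)
    then have "(norm (Y (Suc n) - real (Suc n) *\<^sub>R s))\<^sup>2 = (norm w)\<^sup>2 + 2 * (w \<bullet> (p w - s)) + (norm (p w - s))\<^sup>2"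
      by (simp add: power2_norm_eq_inner inner_add_left inner_add_right inner_commute)
    also have "\<dots> \<le> real n * B\<^sup>2 + 2 * 0 + B\<^sup>2"
      using Suc p(2)[of w] B[OF p(1)[of w]]
      by (intro add_mono mult_left_mono power_mono) (auto simp: w_def)
    finally show ?case by (simp add: algebra_simps)
  qed (simp add: Y)
  have "norm (Y n - real n *\<^sub>R s) \<le> B\<^sup>2 / (4 * \<epsilon>) + \<epsilon> * real n" for n
  proof (rule power2_le_imp_le)
    have "4 * (B\<^sup>2 / (4 * \<epsilon>)) * (\<epsilon> * real n) = real n * B\<^sup>2" using assms(3) by simp
    moreover have "4 * u * v \<le> (u + v)\<^sup>2" for u v :: real
      using zero_le_power2[of "u - v"] by (simp add: power2_eq_square algebra_simps)
    ultimately show "(norm (Y n - real n *\<^sub>R s))\<^sup>2 \<le> (B\<^sup>2 / (4 * \<epsilon>) + \<epsilon> * real n)\<^sup>2"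
      using sq[of n] by (metis order_trans)
  qed (use assms(3) in auto)
  then show ?thesis using p(1) assms(3)
    by (intro exI[of _ y] exI[of _ "B\<^sup>2 / (4 * \<epsilon>)"]) (auto simp: sum_y, simp add: y_def)
qed

section \<open>Supports and measurability\<close>

text \<open>
  The complement of the support is a union of null open sets, which the Lindelof property makes a
  countable union.
\<close>

lemma AE_measure_support:
  fixes M :: "'a::second_countable_topology measure"
  assumes sets: "sets M = sets borel"
  shows "AE y in M. y \<in> measure_support M"
proof -
  define F where "F = {U. open U \<and> emeasure M U = 0}"
  obtain F' where F': "F' \<subseteq> F" "countable F'" "\<Union>F' = \<Union>F"
    using Lindelof[of F] by (auto simp: F_def)
  have "U \<in> null_sets M" if "U \<in> F'" for U
    using that F'(1) sets by (auto simp: F_def null_sets_def)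
  then have "(\<Union>U\<in>F'. U) \<in> null_sets M"
    by (rule null_sets_UN'[OF F'(2)])
  then have "\<Union>F \<in> null_sets M" using F'(3) by simp
  moreover have "{y \<in> space M. y \<notin> measure_support M} \<subseteq> \<Union>F"
    by (auto simp: measure_support_def F_def)
  ultimately show ?thesis by (rule AE_I')
qed

lemma measure_support_subset_closed:
  fixes M :: "'a::topological_space measure"
  assumes sets: "sets M = sets borel" and "closed C" and "AE y in M. y \<in> C"
  shows "measure_support M \<subseteq> C"
proof
  fix x assume x: "x \<in> measure_support M"
  show "x \<in> C"
  proof (rule ccontr)
    assume "x \<notin> C"
    then have "emeasure M (- C) > 0"
      using x assms(2) by (auto simp: measure_support_def)
    moreover have "emeasure M (- C) = 0"
      using assms(3) AE_iff_measurable[of "- C" M "\<lambda>y. y \<in> C"] sets sets_eq_imp_space_eq[OF sets] assms(2)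
      by auto
    ultimately show False by simp
  qed
qed

lemma staying_measurable:
  fixes M :: "'a::euclidean_space measure" and n :: nat
  assumes sets: "sets M = sets borel" and "closed K"
  shows "{\<xi> \<in> space (\<Pi>\<^sub>M i\<in>{..<n}. M). \<forall>j\<in>{1..n}. x + (\<Sum>i<j. \<xi> i) \<in> K} \<in> sets (\<Pi>\<^sub>M i\<in>{..<n}. M)"
proof -
  let ?R = "\<Pi>\<^sub>M i\<in>{..<n}. M"
  have c: "(\<lambda>\<xi>. \<xi> i) \<in> ?R \<rightarrow>\<^sub>M borel" if "i < n" for i
    using measurable_component_singleton[of i "{..<n}" "\<lambda>_. M"] that
    by (simp add: measurable_cong_sets[OF refl sets])
  have K: "K \<in> sets borel" using assms(2) by simp
  have "(\<lambda>\<xi>. x + (\<Sum>i<j. \<xi> i)) \<in> borel_measurable ?R" if "j \<in> {1..n}" for j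
    using that by (intro borel_measurable_add borel_measurable_sum c) auto
  from measurable_sets[OF this K]
  have "{\<xi> \<in> space ?R. x + (\<Sum>i<j. \<xi> i) \<in> K} \<in> sets ?R" if "j \<in> {1..n}" for j
    using that by (simp add: vimage_def Int_def conj_commute)
  then show ?thesis by measurable
qed

section \<open>Laws with exponential moments\<close>

text \<open>
  The moment generating function takes the value \<open>1\<close> at \<open>0\<close>, where its right derivative is the mean.
  This one-sided form of differentiation under the integral serves twice: for the Chernoff bound, and,
  read contrapositively, for the first-order condition at a minimum of the Laplace transform.
\<close>

lemma exp_integral_less_1_if_negative_mean:
  fixes f :: "'a \<Rightarrow> real"
  assumes "prob_space M" and [measurable]: "f \<in> borel_measurable M"
    and "t0 > 0" and int: "integrable M (\<lambda>y. exp (t0 * \<bar>f y\<bar>))"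
    and neg: "(\<integral>y. f y \<partial>M) < 0" and "t1 > 0"
  shows "\<exists>t. 0 < t \<and> t \<le> t1 \<and> integrable M (\<lambda>y. exp (t * f y)) \<and> (\<integral>y. exp (t * f y) \<partial>M) < 1"
proof -
  interpret prob_space M by fact
  \<comment> \<open>Half of the available exponent pays for the factor \<open>\<bar>f y\<bar>\<close> in the dominating function below.\<close>
  define c where "c = min t1 (t0 / 2)"
  define t where "t n = c / real (Suc n)" for n
  have c: "c > 0" "c \<le> t1" "c \<le> t0 / 2" using assms by (auto simp: c_def)
  have t: "t n > 0" "t n \<le> c" for n
    using c by (auto simp: t_def field_simps)
  have intt: "integrable M (\<lambda>y. exp (t n * f y))" for n
  proof (rule Bochner_Integration.integrable_bound[OF int])
    show "AE y in M. norm (exp (t n * f y)) \<le> norm (exp (t0 * \<bar>f y\<bar>))"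
    proof (rule AE_I2)
      fix y
      have "t n * f y \<le> t n * \<bar>f y\<bar>" using t[of n] by (intro mult_left_mono) auto
      also have "\<dots> \<le> t0 * \<bar>f y\<bar>" using t[of n] c assms by (intro mult_right_mono) auto
      finally show "norm (exp (t n * f y)) \<le> norm (exp (t0 * \<bar>f y\<bar>))" by simp
    qed
  qed simp
  define s where "s n y = (exp (t n * f y) - 1) / t n" for n y
  have t_lim: "t \<longlonglongrightarrow> 0"
    unfolding t_def using LIMSEQ_Suc[OF lim_const_over_n[of c]] by simp
  have "(\<lambda>n. \<integral>y. s n y \<partial>M) \<longlonglongrightarrow> (\<integral>y. f y \<partial>M)"
  proof (rule integral_dominated_convergence)
    show "f \<in> borel_measurable M" by simp
    show "s n \<in> borel_measurable M" for n unfolding s_def by simp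
    show "integrable M (\<lambda>y. (2 / t0) * exp (t0 * \<bar>f y\<bar>))" using int by simp
    show "AE y in M. (\<lambda>n. s n y) \<longlonglongrightarrow> f y"
    proof (rule AE_I2)
      fix y
      have "((\<lambda>h. exp (h * f y)) has_real_derivative f y) (at 0)"
        by (auto intro!: derivative_eq_intros)
      then have "((\<lambda>h. (exp (h * f y) - 1) / h) \<longlongrightarrow> f y) (at 0)"
        by (simp add: DERIV_def)
      moreover have "filterlim t (at 0) sequentially"
        using t_lim t(1) by (auto simp: filterlim_at intro!: always_eventually less_imp_neq[symmetric])
      ultimately show "(\<lambda>n. s n y) \<longlonglongrightarrow> f y"
        unfolding s_def by (rule filterlim_compose)
    qed
    \<comment> \<open>By \<open>\<bar>exp u - 1\<bar> \<le> \<bar>u\<bar> * exp \<bar>u\<bar>\<close> the difference quotients are dominated.\<close>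
    show "AE y in M. norm (s n y) \<le> (2 / t0) * exp (t0 * \<bar>f y\<bar>)" for n
    proof (rule AE_I2)
      fix y
      have 1: "\<bar>exp u - 1\<bar> \<le> \<bar>u\<bar> * exp \<bar>u\<bar>" for u :: real
      proof (cases "u \<ge> 0")
        case True
        have "exp u * (1 - u) \<le> exp u * exp (- u)"
          using exp_ge_add_one_self[of "-u"] by (intro mult_left_mono) auto
        then show ?thesis using True by (simp add: algebra_simps exp_minus)
      next
        case False
        have "1 + u \<le> exp u" by (rule exp_ge_add_one_self)
        moreover have "- u * 1 \<le> - u * exp (- u)" using False by (intro mult_left_mono) auto
        ultimately have "1 - exp u \<le> - u * exp (- u)" by linarith
        then show ?thesis using False by simp
      qed
      have "\<bar>s n y\<bar> = \<bar>exp (t n * f y) - 1\<bar> / t n" using t(1)[of n] by (simp add: s_def)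
      also have "\<dots> \<le> \<bar>t n * f y\<bar> * exp \<bar>t n * f y\<bar> / t n"
        using 1[of "t n * f y"] t(1)[of n] by (intro divide_right_mono) auto
      also have "\<dots> = \<bar>f y\<bar> * exp (t n * \<bar>f y\<bar>)" using t(1)[of n] by (simp add: abs_mult)
      also have "\<dots> \<le> (2 / t0 * exp (t0 / 2 * \<bar>f y\<bar>)) * exp (t0 / 2 * \<bar>f y\<bar>)"
      proof (rule mult_mono)
        show "\<bar>f y\<bar> \<le> 2 / t0 * exp (t0 / 2 * \<bar>f y\<bar>)"
          using exp_ge_add_one_self[of "t0 / 2 * \<bar>f y\<bar>"] assms by (simp add: field_simps)
        show "exp (t n * \<bar>f y\<bar>) \<le> exp (t0 / 2 * \<bar>f y\<bar>)"
          unfolding exp_le_cancel_iff using t(2)[of n] c(3) by (intro mult_right_mono) auto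
      qed (use assms in auto)
      also have "\<dots> = (2 / t0) * exp (t0 * \<bar>f y\<bar>)"
        by (simp flip: exp_add)
      finally show "norm (s n y) \<le> (2 / t0) * exp (t0 * \<bar>f y\<bar>)" by simp
    qed
  qed
  then have "eventually (\<lambda>n. (\<integral>y. s n y \<partial>M) < 0) sequentially"
    using neg by (rule order_tendstoD)
  then obtain n where "(\<integral>y. s n y \<partial>M) < 0"
    using eventually_happens trivial_limit_sequentially by blast
  moreover have "(\<integral>y. s n y \<partial>M) = ((\<integral>y. exp (t n * f y) \<partial>M) - 1) / t n"
    unfolding s_def using intt[of n] by (simp add: prob_space)
  ultimately have "(\<integral>y. exp (t n * f y) \<partial>M) < 1"
    using t(1)[of n] by (simp add: divide_less_0_iff)
  then show ?thesis using t[of n] c intt[of n] by (intro exI[of _ "t n"]) auto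
qed

text \<open>
  The exponent may depend on the direction \<open>u\<close>, since each direction is used separately.
\<close>

locale exponential_moments = prob_space M for M :: "'a::euclidean_space measure" +
  assumes sets_M[measurable_cong, simp]: "sets M = sets borel"
    and exp_moment: "\<exists>t>0. integrable M (\<lambda>y. exp (t * \<bar>u \<bullet> y\<bar>))"

begin

lemma space_M[simp]: "space M = UNIV"
  using sets_eq_imp_space_eq[OF sets_M] by simp

lemma prob_space_UNIV[simp]: "prob UNIV = 1"
  using prob_space by simp

lemma coordinate_measurable:
  "i < n \<Longrightarrow> (\<lambda>\<xi>. \<xi> i) \<in> (\<Pi>\<^sub>M i\<in>{..<n}. M) \<rightarrow>\<^sub>M borel"
  using measurable_component_singleton[of i "{..<n}" "\<lambda>_. M"] by simp

lemma coordinate_event_measurable: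
  assumes "i < n" "E \<in> sets borel"
  shows "{\<xi> \<in> space (\<Pi>\<^sub>M i\<in>{..<n}. M). \<xi> i \<in> E} \<in> sets (\<Pi>\<^sub>M i\<in>{..<n}. M)"
  using measurable_sets[OF coordinate_measurable[OF assms(1)] assms(2)]
  by (simp add: vimage_def Int_def conj_commute)

lemma integrable_inner: "integrable M (\<lambda>y. u \<bullet> y)"
proof -
  obtain t where t: "t > 0" "integrable M (\<lambda>y. exp (t * \<bar>u \<bullet> y\<bar>))"
    using exp_moment by blast
  have "integrable M (\<lambda>y. (1 / t) * exp (t * \<bar>u \<bullet> y\<bar>))" using t by simp
  then show ?thesis
  proof (rule Bochner_Integration.integrable_bound)
    show "AE y in M. norm (u \<bullet> y) \<le> norm ((1 / t) * exp (t * \<bar>u \<bullet> y\<bar>))"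
    proof (rule AE_I2)
      fix y
      show "norm (u \<bullet> y) \<le> norm ((1 / t) * exp (t * \<bar>u \<bullet> y\<bar>))"
        using less_imp_le[OF exp_gt_self[of "t * \<bar>u \<bullet> y\<bar>"]] t(1) by (simp add: field_simps)
    qed
  qed simp
qed

lemma integrable_identity: "integrable M (\<lambda>y. y)"
proof -
  have "integrable M (\<lambda>y. \<Sum>b\<in>Basis. (b \<bullet> y) *\<^sub>R b)"
    by (intro Bochner_Integration.integrable_sum integrable_scaleR_left integrable_inner)
  also have "(\<lambda>y. \<Sum>b\<in>Basis. (b \<bullet> y) *\<^sub>R b) = (\<lambda>y::'a. y)"
    by (rule ext) (subst inner_commute, rule euclidean_representation)
  finally show ?thesis .
qed

definition mean :: 'a where "mean = (\<integral>y. y \<partial>M)"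

lemma integral_inner: "(\<integral>y. u \<bullet> y \<partial>M) = u \<bullet> mean"
  unfolding mean_def by (intro integral_inner_right) (rule integrable_identity)

lemma exp_integral_inner_less_1:
  assumes "u \<bullet> mean < c" "t1 > 0"
  shows "\<exists>t. 0 < t \<and> t \<le> t1 \<and> integrable M (\<lambda>y. exp (t * (u \<bullet> y - c)))
    \<and> (\<integral>y. exp (t * (u \<bullet> y - c)) \<partial>M) < 1"
proof -
  obtain t where t: "t > 0" "integrable M (\<lambda>y. exp (t * \<bar>u \<bullet> y\<bar>))"
    using exp_moment by blast
  have "integrable M (\<lambda>y. exp (t * \<bar>c\<bar>) * exp (t * \<bar>u \<bullet> y\<bar>))" using t by simp
  then have "integrable M (\<lambda>y. exp (t * \<bar>u \<bullet> y - c\<bar>))"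
  proof (rule Bochner_Integration.integrable_bound)
    show "AE y in M. norm (exp (t * \<bar>u \<bullet> y - c\<bar>)) \<le> norm (exp (t * \<bar>c\<bar>) * exp (t * \<bar>u \<bullet> y\<bar>))"
    proof (rule AE_I2)
      fix y
      have "t * \<bar>u \<bullet> y - c\<bar> \<le> t * (\<bar>c\<bar> + \<bar>u \<bullet> y\<bar>)" using t(1) by (intro mult_left_mono) auto
      then show "norm (exp (t * \<bar>u \<bullet> y - c\<bar>)) \<le> norm (exp (t * \<bar>c\<bar>) * exp (t * \<bar>u \<bullet> y\<bar>))"
        by (simp add: distrib_left flip: exp_add)
    qed
  qed simp
  moreover have "(\<integral>y. u \<bullet> y - c \<partial>M) < 0"
    using assms(1) integrable_inner[of u] by (simp add: integral_inner prob_space_UNIV)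
  ultimately show ?thesis
    using t(1) assms(2) by (intro exp_integral_less_1_if_negative_mean) (auto intro: prob_space_axioms)
qed

lemma Chernoff_factor:
  assumes "a > 0"
  shows "\<exists>\<theta>>0. (\<integral>\<^sup>+y. ennreal (exp (\<theta> * (u \<bullet> (y - mean) - a))) \<partial>M) \<le> 1"
proof -
  obtain t where t: "t > 0" "integrable M (\<lambda>y. exp (t * (u \<bullet> y - (u \<bullet> mean + a))))"
    "(\<integral>y. exp (t * (u \<bullet> y - (u \<bullet> mean + a))) \<partial>M) < 1"
    using exp_integral_inner_less_1[of u "u \<bullet> mean + a" 1] assms by auto
  have "(\<integral>\<^sup>+y. ennreal (exp (t * (u \<bullet> (y - mean) - a))) \<partial>M) =
      ennreal (\<integral>y. exp (t * (u \<bullet> y - (u \<bullet> mean + a))) \<partial>M)"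
    using t(2) by (subst nn_integral_eq_integral[symmetric]) (auto simp: inner_diff_right diff_diff_eq)
  then show ?thesis using t(1,3) by (intro exI[of _ t]) simp
qed

lemma nn_integral_product:
  assumes "finite I" and "\<And>i. i \<in> I \<Longrightarrow> f i \<in> borel_measurable borel"
  shows "(\<integral>\<^sup>+\<xi>. (\<Prod>i\<in>I. f i (\<xi> i)) \<partial>(\<Pi>\<^sub>M i\<in>I. M)) = (\<Prod>i\<in>I. \<integral>\<^sup>+y. f i y \<partial>M)"
proof -
  interpret P: product_sigma_finite "\<lambda>_. M" by standard
  show ?thesis using assms by (intro P.product_nn_integral_prod) auto
qed

lemma prob_space_product: "prob_space (\<Pi>\<^sub>M i\<in>I. M)"
  by (intro prob_space_PiM prob_space_axioms)

end

section \<open>Fluctuations after a prescribed beginning\<close>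

context exponential_moments
begin

lemma emeasure_prefix:
  fixes k n :: nat
  assumes "k \<le> n" and [measurable]: "\<And>i. E i \<in> sets borel"
  shows "emeasure (\<Pi>\<^sub>M i\<in>{..<n}. M) {\<xi> \<in> space (\<Pi>\<^sub>M i\<in>{..<n}. M). \<forall>i<k. \<xi> i \<in> E i} = (\<Prod>i<k. emeasure M (E i))"
proof -
  let ?P = "\<Pi>\<^sub>M i\<in>{..<n}. M"
  interpret P: product_sigma_finite "\<lambda>_. M" by standard
  have "{\<xi> \<in> space ?P. \<forall>i<k. \<xi> i \<in> E i} = Pi\<^sub>E {..<n} (\<lambda>i. if i < k then E i else UNIV)"
  proof (intro equalityI subsetI)
    fix \<xi> assume "\<xi> \<in> Pi\<^sub>E {..<n} (\<lambda>i. if i < k then E i else UNIV)"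
    then have "\<xi> \<in> extensional {..<n}" and *: "\<And>i. i < n \<Longrightarrow> i < k \<Longrightarrow> \<xi> i \<in> E i"
      by (auto simp: PiE_iff split: if_splits)
    moreover have "\<xi> i \<in> E i" if "i < k" for i using * that assms(1) by simp
    ultimately show "\<xi> \<in> {\<xi> \<in> space ?P. \<forall>i<k. \<xi> i \<in> E i}"
      by (simp add: space_PiM PiE_iff)
  qed (auto simp: space_PiM PiE_iff)
  also have "emeasure ?P \<dots> = (\<Prod>i<n. emeasure M (if i < k then E i else UNIV))"
    by (rule P.emeasure_PiM) auto
  also have "\<dots> = (\<Prod>i<k. emeasure M (E i))"
    using assms(1) emeasure_space_1
    by (intro prod.mono_neutral_cong_right) auto
  finally show ?thesis .
qed

text \<open>
  Markov's inequality for \<open>exp (\<theta> * (\<Sum>i=k..<j. f (\<xi> i) - a))\<close> restricted to the event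
  \<open>\<forall>i<k. \<xi> i \<in> E i\<close>. The integrand is a product of functions of the single coordinates, so
  the constraint on the beginning of the path factors out exactly. Of the
  threshold \<open>2 * a * n\<close> one half is consumed by the centring with \<open>a\<close> in each of at most \<open>n\<close> terms.
\<close>

lemma emeasure_prefix_and_large_sum:
  assumes kj: "k \<le> j" "j \<le> n" and [measurable]: "\<And>i. E i \<in> sets borel"
    and [measurable]: "f \<in> borel_measurable borel"
    and \<theta>: "\<theta> > 0" and "a \<ge> 0"
    and fac: "(\<integral>\<^sup>+y. ennreal (exp (\<theta> * (f y - a))) \<partial>M) \<le> 1"
  shows "emeasure (\<Pi>\<^sub>M i\<in>{..<n}. M)
      {\<xi> \<in> space (\<Pi>\<^sub>M i\<in>{..<n}. M). (\<forall>i<k. \<xi> i \<in> E i) \<and> (\<Sum>i=k..<j. f (\<xi> i)) \<ge> 2 * a * real n}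
    \<le> ennreal (exp (- (\<theta> * a * real n))) * (\<Prod>i<k. emeasure M (E i))"
proof -
  let ?P = "\<Pi>\<^sub>M i\<in>{..<n}. M"
  let ?A = "{\<xi> \<in> space ?P. (\<forall>i<k. \<xi> i \<in> E i) \<and> (\<Sum>i=k..<j. f (\<xi> i)) \<ge> 2 * a * real n}"
  \<comment> \<open>A factor for each coordinate: the constraint before \<open>k\<close>, the exponential tilt up to \<open>j\<close>, nothing afterwards.\<close>
  define h where "h i y = (if i < k then indicator (E i) y else
      if i < j then ennreal (exp (\<theta> * (f y - a))) else 1)" for i :: nat and y
  have h[measurable]: "h i \<in> borel_measurable borel" for i
    by (cases "i < k"; cases "i < j") (simp_all add: h_def[abs_def])
  have meas: "?A \<in> sets ?P"
  proof -
    have [measurable]: "(\<lambda>\<xi>. \<xi> i) \<in> ?P \<rightarrow>\<^sub>M borel" if "i < n" for i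
      using that by (rule coordinate_measurable)
    have "(\<lambda>\<xi>. \<Sum>i=k..<j. f (\<xi> i)) \<in> borel_measurable ?P"
      using kj by (intro borel_measurable_sum) auto
    moreover have "{\<xi> \<in> space ?P. \<xi> i \<in> E i} \<in> sets ?P" if "i < k" for i
      using that kj by (intro coordinate_event_measurable) auto
    ultimately show ?thesis by measurable
  qed
  have "indicator ?A \<xi> \<le> ennreal (exp (- (\<theta> * a * real n))) * (\<Prod>i<n. h i (\<xi> i))" for \<xi>
  proof (cases "\<xi> \<in> ?A")
    case True
    then have E: "\<And>i. i < k \<Longrightarrow> \<xi> i \<in> E i" and S: "(\<Sum>i=k..<j. f (\<xi> i)) \<ge> 2 * a * real n" by auto
    have "(\<Prod>i<n. h i (\<xi> i)) = (\<Prod>i=k..<j. ennreal (exp (\<theta> * (f (\<xi> i) - a))))"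
      using kj E by (intro prod.mono_neutral_cong_right) (auto simp: h_def)
    also have "\<dots> = ennreal (exp (\<Sum>i=k..<j. \<theta> * (f (\<xi> i) - a)))"
      by (simp add: prod_ennreal exp_sum)
    also have "(\<Sum>i=k..<j. \<theta> * (f (\<xi> i) - a)) = \<theta> * ((\<Sum>i=k..<j. f (\<xi> i)) - a * real (j - k))"
      by (simp add: sum_subtractf algebra_simps flip: sum_distrib_left)
    finally have 1: "(\<Prod>i<n. h i (\<xi> i)) = ennreal (exp (\<theta> * ((\<Sum>i=k..<j. f (\<xi> i)) - a * real (j - k))))" .
    have "a * real (j - k) \<le> a * real n" using kj assms(6) by (intro mult_left_mono) auto
    then have "\<theta> * (a * real n) \<le> \<theta> * ((\<Sum>i=k..<j. f (\<xi> i)) - a * real (j - k))"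
      using S \<theta> by (intro mult_left_mono) auto
    then have "1 \<le> exp (- (\<theta> * a * real n)) * exp (\<theta> * ((\<Sum>i=k..<j. f (\<xi> i)) - a * real (j - k)))"
      by (simp flip: exp_add add: mult.assoc)
    then show ?thesis unfolding 1 using True by (simp flip: ennreal_mult)
  qed simp
  then have "(\<integral>\<^sup>+\<xi>. indicator ?A \<xi> \<partial>?P) \<le>
      (\<integral>\<^sup>+\<xi>. ennreal (exp (- (\<theta> * a * real n))) * (\<Prod>i<n. h i (\<xi> i)) \<partial>?P)"
    by (intro nn_integral_mono)
  also have "\<dots> = ennreal (exp (- (\<theta> * a * real n))) * (\<integral>\<^sup>+\<xi>. (\<Prod>i<n. h i (\<xi> i)) \<partial>?P)"
  proof (rule nn_integral_cmult)
    show "(\<lambda>\<xi>. \<Prod>i<n. h i (\<xi> i)) \<in> borel_measurable ?P"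
    proof (rule borel_measurable_prod_ennreal)
      fix i assume "i \<in> {..<n}"
      then have [measurable]: "(\<lambda>\<xi>. \<xi> i) \<in> ?P \<rightarrow>\<^sub>M borel"
        by (intro coordinate_measurable) simp
      show "(\<lambda>\<xi>. h i (\<xi> i)) \<in> borel_measurable ?P" by measurable
    qed
  qed
  finally have 1: "emeasure ?P ?A \<le> ennreal (exp (- (\<theta> * a * real n))) * (\<integral>\<^sup>+\<xi>. (\<Prod>i<n. h i (\<xi> i)) \<partial>?P)"
    unfolding nn_integral_indicator[OF meas] .
  have "(\<integral>\<^sup>+\<xi>. (\<Prod>i<n. h i (\<xi> i)) \<partial>?P) = (\<Prod>i<n. \<integral>\<^sup>+y. h i y \<partial>M)"
    by (rule nn_integral_product) auto
  also have "\<dots> \<le> (\<Prod>i<n. if i < k then emeasure M (E i) else 1)"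
  proof (rule prod_mono_ennreal)
    fix i
    show "(\<integral>\<^sup>+y. h i y \<partial>M) \<le> (if i < k then emeasure M (E i) else 1)"
      using fac emeasure_space_1 by (cases "i < k"; cases "i < j") (simp_all add: h_def)
  qed
  also have "\<dots> = (\<Prod>i<k. emeasure M (E i))"
    using kj by (intro prod.mono_neutral_cong_right) auto
  finally show ?thesis by (intro order_trans[OF 1] mult_left_mono) simp_all
qed

text \<open>
  Large fluctuations are detected by some signed coordinate at some time. There are at most linearly many
  times, each with an exponentially small conditional probability, so a union bound suffices.
  The threshold for \<open>n\<close> is uniform in \<open>k\<close> and \<open>E\<close>, so that both may later depend on \<open>n\<close>.
\<close>

lemma eventually_small_fluctuations:
  assumes "a > 0"
  shows "\<forall>\<^sub>F n in sequentially. \<forall>k\<le>n. \<forall>E. (\<forall>i. E i \<in> sets borel) \<longrightarrow>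
    (\<Prod>i<k. prob (E i)) / 2 \<le> measure (\<Pi>\<^sub>M i\<in>{..<n}. M)
      {\<xi> \<in> space (\<Pi>\<^sub>M i\<in>{..<n}. M). (\<forall>i<k. \<xi> i \<in> E i) \<and>
        (\<forall>j\<in>{k..n}. norm (\<Sum>i=k..<j. \<xi> i - mean) \<le> a * real n)}"
proof -
  \<comment> \<open>Small enough that \<open>2 * a' * n\<close> in each coordinate adds up to \<open>a * n\<close> in norm.\<close>
  define a' where "a' = a / (2 * real DIM('a))"
  have a': "a' > 0" using assms by (simp add: a'_def)
  define D where "D = (Basis :: 'a set) \<union> uminus ` Basis"
  have D: "finite D" by (simp add: D_def)
  obtain \<theta> where \<theta>: "\<And>u. \<theta> u > 0"
      "\<And>u. (\<integral>\<^sup>+y. ennreal (exp (\<theta> u * (u \<bullet> (y - mean) - a'))) \<partial>M) \<le> 1"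
    using Chernoff_factor[OF a'] by metis
  define err where "err n = (\<Sum>u\<in>D. real (Suc n) * exp (- (\<theta> u * a' * real n)))" for n
  have "(\<lambda>n. real (Suc n) * exp (- (c * real n))) \<longlonglongrightarrow> 0" if "c > 0" for c :: real
    using that by real_asymp
  then have "err \<longlonglongrightarrow> 0"
    unfolding err_def[abs_def] using \<theta>(1) a' by (intro tendsto_null_sum) auto
  then have "\<forall>\<^sub>F n in sequentially. err n < 1 / 2" by (rule order_tendstoD) simp
  then show ?thesis
  proof (eventually_elim, intro allI impI)
    fix n k and E :: "nat \<Rightarrow> 'a set"
    assume err: "err n < 1 / 2" and k: "k \<le> n" and E: "\<forall>i. E i \<in> sets borel"
    let ?P = "\<Pi>\<^sub>M i\<in>{..<n}. M"
    interpret P: prob_space ?P by (rule prob_space_product)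
    have E'[measurable]: "E i \<in> sets borel" for i using E by simp
    have comp[measurable]: "(\<lambda>\<xi>. \<xi> i) \<in> ?P \<rightarrow>\<^sub>M borel" if "i < n" for i
      using that by (rule coordinate_measurable)
    define A where "A = {\<xi> \<in> space ?P. \<forall>i<k. \<xi> i \<in> E i}"
    define G where "G = {\<xi> \<in> space ?P. (\<forall>i<k. \<xi> i \<in> E i) \<and>
        (\<forall>j\<in>{k..n}. norm (\<Sum>i=k..<j. \<xi> i - mean) \<le> a * real n)}"
    define B where "B = (\<lambda>(u, j). {\<xi> \<in> space ?P. (\<forall>i<k. \<xi> i \<in> E i) \<and>
        (\<Sum>i=k..<j. u \<bullet> (\<xi> i - mean)) \<ge> 2 * a' * real n})"
    have E_meas: "{\<xi> \<in> space ?P. \<xi> i \<in> E i} \<in> sets ?P" if "i < k" for i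
      using that k by (intro coordinate_event_measurable) auto
    have A[measurable]: "A \<in> sets ?P" unfolding A_def using E_meas by measurable
    have G[measurable]: "G \<in> sets ?P"
    proof -
      have "(\<lambda>\<xi>. \<Sum>i=k..<j. \<xi> i - mean) \<in> borel_measurable ?P" if "j \<in> {k..n}" for j
        using that by (intro borel_measurable_sum borel_measurable_diff) auto
      then have "{\<xi> \<in> space ?P. norm (\<Sum>i=k..<j. \<xi> i - mean) \<le> a * real n} \<in> sets ?P"
        if "j \<in> {k..n}" for j
        using that by (intro borel_measurable_le borel_measurable_const measurable_compose[OF _ borel_measurable_norm]) auto
      then show ?thesis unfolding G_def using E_meas by measurable
    qed
    have B[measurable]: "B (u, j) \<in> sets ?P" if "j \<in> {k..n}" for u j
    proof -
      have "(\<lambda>\<xi>. \<Sum>i=k..<j. u \<bullet> (\<xi> i - mean)) \<in> borel_measurable ?P"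
        using that by (intro borel_measurable_sum borel_measurable_inner borel_measurable_diff) auto
      then show ?thesis unfolding B_def prod.case using E_meas by measurable
    qed
    define p where "p = (\<Prod>i<k. prob (E i))"
    have p0: "p \<ge> 0" unfolding p_def by (intro prod_nonneg) auto
    have p: "(\<Prod>i<k. emeasure M (E i)) = ennreal p"
      by (simp add: p_def emeasure_eq_measure prod_ennreal)
    have mA: "measure ?P A = p"
      using emeasure_prefix[OF k, of E] p p0 by (simp add: A_def measure_def)
    have mB: "measure ?P (B (u, j)) \<le> exp (- (\<theta> u * a' * real n)) * p" if "j \<in> {k..n}" for u j
    proof -
      have "emeasure ?P (B (u, j)) \<le> ennreal (exp (- (\<theta> u * a' * real n))) * (\<Prod>i<k. emeasure M (E i))"
        unfolding B_def prod.case
        by (rule emeasure_prefix_and_large_sum[where f = "\<lambda>y. u \<bullet> (y - mean)"])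
           (use that \<theta> a' in \<open>auto intro: less_imp_le\<close>)
      then show ?thesis using p p0 by (simp add: P.emeasure_eq_measure flip: ennreal_mult)
    qed
    have sub: "A \<subseteq> G \<union> (\<Union>x\<in>D \<times> {k..n}. B x)"
    proof
      fix \<xi> assume xi: "\<xi> \<in> A"
      show "\<xi> \<in> G \<union> (\<Union>x\<in>D \<times> {k..n}. B x)"
      proof (cases "\<xi> \<in> G")
        case False
        then obtain j where j: "j \<in> {k..n}" "norm (\<Sum>i=k..<j. \<xi> i - mean) > a * real n"
          using xi by (auto simp: A_def G_def not_le)
        define w where "w = (\<Sum>i=k..<j. \<xi> i - mean)"
        have "\<exists>b\<in>Basis. \<bar>w \<bullet> b\<bar> \<ge> 2 * a' * real n"
        proof (rule ccontr)
          assume "\<not> ?thesis"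
          then have "(\<Sum>b\<in>Basis. \<bar>w \<bullet> b\<bar>) \<le> (\<Sum>b\<in>(Basis::'a set). 2 * a' * real n)"
            by (intro sum_mono) (auto simp: not_le)
          also have "\<dots> = a * real n" by (simp add: a'_def)
          finally show False using norm_le_l1[of w] j(2) by (simp add: w_def)
        qed
        then obtain b where b: "b \<in> Basis" "\<bar>w \<bullet> b\<bar> \<ge> 2 * a' * real n" by blast
        define u where "u = (if w \<bullet> b \<ge> 0 then b else - b)"
        have "u \<in> D" using b by (auto simp: u_def D_def)
        moreover have "u \<bullet> w \<ge> 2 * a' * real n" using b(2) by (auto simp: u_def inner_commute)
        ultimately show ?thesis using xi j(1)
          by (auto simp: A_def B_def w_def inner_sum_right intro!: bexI[of _ u] bexI[of _ j])
      qed simp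
    qed
    have "p \<le> measure ?P (G \<union> (\<Union>x\<in>D \<times> {k..n}. B x))"
      unfolding mA[symmetric] using D by (intro P.finite_measure_mono sub sets.Un G sets.finite_UN) auto
    also have "\<dots> \<le> measure ?P G + measure ?P (\<Union>x\<in>D \<times> {k..n}. B x)"
      using D by (intro measure_Un_le G sets.finite_UN) auto
    also have "measure ?P (\<Union>x\<in>D \<times> {k..n}. B x) \<le> (\<Sum>x\<in>D \<times> {k..n}. measure ?P (B x))"
      using D by (intro P.finite_measure_subadditive_finite) auto
    also have "\<dots> = (\<Sum>u\<in>D. \<Sum>j\<in>{k..n}. measure ?P (B (u, j)))"
      by (simp add: sum.cartesian_product)
    also have "\<dots> \<le> (\<Sum>u\<in>D. real (card {k..n}) * (exp (- (\<theta> u * a' * real n)) * p))"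
      by (intro sum_mono sum_bounded_above mB)
    also have "\<dots> \<le> (\<Sum>u\<in>D. real (Suc n) * (exp (- (\<theta> u * a' * real n)) * p))"
      using p0 by (intro sum_mono mult_right_mono) auto
    also have "\<dots> = err n * p" by (simp add: err_def sum_distrib_right mult.assoc)
    also have "\<dots> \<le> (1 / 2) * p" using err p0 by (intro mult_right_mono) auto
    finally show "(\<Prod>i<k. prob (E i)) / 2 \<le> measure ?P {\<xi> \<in> space ?P. (\<forall>i<k. \<xi> i \<in> E i) \<and>
        (\<forall>j\<in>{k..n}. norm (\<Sum>i=k..<j. \<xi> i - mean) \<le> a * real n)}"
      unfolding p_def[symmetric] G_def[symmetric] by simp
  qed
qed

end

section \<open>Staying in the cone at subexponential cost\<close>

context exponential_moments
begin

text \<open>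
  Otherwise a hyperplane with normal \<open>a\<close> separates the support from \<open>K\<close>, that is, \<open>a \<bullet> y \<le> 0\<close> almost
  surely and \<open>a \<bullet> z \<ge> 0\<close> for \<open>z \<in> K\<close>. As the mean lies in \<open>K\<close>, the nonpositive variable \<open>a \<bullet> y\<close> has nonnegative
  mean, so it vanishes almost surely.
\<close>

lemma interior_meets_hull_of_support:
  assumes K: "convex_cone K" "interior K \<noteq> {}" and "mean \<in> K"
    and nondeg: "\<And>a. a \<noteq> 0 \<Longrightarrow> \<not> (AE y in M. a \<bullet> y = 0)"
  obtains S s where "finite S" "S \<subseteq> measure_support M" "s \<in> convex hull S" "s \<in> interior K"
proof -
  have "convex hull (measure_support M) \<inter> interior K \<noteq> {}"
  proof
    assume disj: "convex hull (measure_support M) \<inter> interior K = {}"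
    have AE_supp: "AE y in M. y \<in> measure_support M" by (rule AE_measure_support) simp
    have "measure_support M \<noteq> {}"
    proof
      assume "measure_support M = {}"
      with AE_supp have "AE y in M. False" by simp
      then show False by simp
    qed
    then have ne: "convex hull (measure_support M) \<noteq> {}" by simp
    have "convex (interior K)" using K(1) by (simp add: convex_cone_def convex_interior)
    from separating_hyperplane_sets[OF convex_convex_hull this ne K(2) disj]
    obtain a b where ab: "a \<noteq> 0" "\<And>y. y \<in> convex hull (measure_support M) \<Longrightarrow> a \<bullet> y \<le> b"
        "\<And>z. z \<in> interior K \<Longrightarrow> b \<le> a \<bullet> z"
      by blast
    have "closure (interior K) \<subseteq> {z. b \<le> a \<bullet> z}"
      using ab(3) by (intro closure_minimal) (auto simp: closed_halfspace_ge)
    moreover have "K \<subseteq> closure (interior K)"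
      using K closure_subset convex_closure_interior[of K] by (auto simp: convex_cone_def)
    ultimately have b_le: "b \<le> a \<bullet> z" if "z \<in> K" for z using that by auto
    have "b \<le> 0" using b_le[OF convex_cone_contains_0[OF K(1)]] by simp
    then have le: "AE y in M. a \<bullet> y \<le> 0"
      using AE_supp by (auto elim!: eventually_mono dest: ab(2)[OF hull_inc])
    have "a \<bullet> mean \<ge> 0"
    proof (rule ccontr)
      assume neg: "\<not> a \<bullet> mean \<ge> 0"
      \<comment> \<open>A positive multiple of the mean with inner product \<open>b - 1\<close> would violate the bound on the cone.\<close>
      have "b \<le> a \<bullet> (((b - 1) / (a \<bullet> mean)) *\<^sub>R mean)"
        using neg \<open>b \<le> 0\<close> by (intro b_le convex_cone_scaleR[OF K(1)] assms(3)) (auto simp: divide_nonpos_nonpos)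
      then show False using neg by simp
    qed
    then have "(\<integral>y. - (a \<bullet> y) \<partial>M) \<le> 0" by (simp add: integral_inner)
    moreover have "(\<integral>y. - (a \<bullet> y) \<partial>M) \<ge> 0"
      using le by (intro integral_nonneg_AE) (auto elim: eventually_mono)
    ultimately have "(\<integral>y. - (a \<bullet> y) \<partial>M) = 0" by simp
    then have "AE y in M. - (a \<bullet> y) = 0"
      using le integrable_inner[of a]
      by (subst (asm) integral_nonneg_eq_0_iff_AE) (auto elim: eventually_mono)
    with nondeg[OF ab(1)] show False by simp
  qed
  then obtain s where s: "s \<in> convex hull (measure_support M)" "s \<in> interior K" by blast
  then obtain S where "finite S" "S \<subseteq> measure_support M" "s \<in> convex hull S"
    using caratheodory[of "measure_support M"] by blast
  with s show ?thesis using that by blast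
qed

lemma confined_measurable:
  fixes n :: nat
  assumes "closed K"
  shows "{\<xi> \<in> space (\<Pi>\<^sub>M i\<in>{..<n}. M). (\<forall>j\<in>{1..n}. x + (\<Sum>i<j. \<xi> i) \<in> K) \<and>
      norm ((\<Sum>i<n. \<xi> i) - z) \<le> c} \<in> sets (\<Pi>\<^sub>M i\<in>{..<n}. M)"
proof -
  have "(\<lambda>\<xi>. \<Sum>i<n. \<xi> i) \<in> borel_measurable (\<Pi>\<^sub>M i\<in>{..<n}. M)"
    by (intro borel_measurable_sum coordinate_measurable) auto
  then have "{\<xi> \<in> space (\<Pi>\<^sub>M i\<in>{..<n}. M). norm ((\<Sum>i<n. \<xi> i) - z) \<le> c} \<in> sets (\<Pi>\<^sub>M i\<in>{..<n}. M)"
    by measurable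
  with staying_measurable[OF sets_M assms] show ?thesis by measurable
qed

text \<open>
  The two phases described at the beginning. The walk first follows, for \<open>k \<approx> \<alpha> * n\<close> steps, a sequence
  of support points shadowing the ray through \<open>s\<close>, and thereby reaches depth \<open>\<epsilon> * k\<close>; afterwards its
  deviation from the drift does not exceed this depth. The error of the first phase is a constant \<open>D\<close>,
  absorbed by starting at depth \<open>D\<close>, plus a part growing linearly, absorbed by the depth of the
  multiples of \<open>s\<close>.
\<close>

lemma eventually_confined:
  assumes "closed K" and K: "convex_cone K" and v: "v \<in> interior K" and mean: "mean \<in> K"
    and nondeg: "\<And>a. a \<noteq> 0 \<Longrightarrow> \<not> (AE y in M. a \<bullet> y = 0)"
  shows "\<exists>\<delta>\<ge>0. \<forall>x\<in>shifted_cone K v \<delta>. \<forall>\<eta>>0. \<forall>\<^sub>F n in sequentially.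
    exp (- (\<eta> * real n)) \<le> measure (\<Pi>\<^sub>M i\<in>{..<n}. M)
      {\<xi> \<in> space (\<Pi>\<^sub>M i\<in>{..<n}. M). (\<forall>j\<in>{1..n}. x + (\<Sum>i<j. \<xi> i) \<in> K) \<and>
        norm ((\<Sum>i<n. \<xi> i) - real n *\<^sub>R mean) \<le> \<eta> * real n}"
proof -
  obtain S s where S: "finite S" "S \<subseteq> measure_support M" "s \<in> convex hull S" "s \<in> interior K"
    using interior_meets_hull_of_support[OF K _ mean nondeg] v by blast
  obtain e where e: "e > 0" "cball s e \<subseteq> K" using S(4) mem_interior_cball by blast
  define \<epsilon> where "\<epsilon> = e / 3"
  have \<epsilon>: "\<epsilon> > 0" "cball s (3 * \<epsilon>) \<subseteq> K" using e by (auto simp: \<epsilon>_def)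
  obtain r where r: "r > 0" "cball v r \<subseteq> K" using v mem_interior_cball by blast
  obtain y D where y: "\<And>n. y n \<in> S" and D: "D \<ge> 0"
    "\<And>n. norm ((\<Sum>i<n. y i) - real n *\<^sub>R s) \<le> D + \<epsilon> * real n"
    using greedy_walk_close_to_line[OF S(1,3) \<epsilon>(1)] by blast
  \<comment> \<open>Positive because \<open>S\<close> is finite: a lower bound for the probability of every prescribed step.\<close>
  define p where "p = Min ((\<lambda>z. prob (ball z \<epsilon>)) ` S)"
  have p_le: "p \<le> prob (ball (y i) \<epsilon>)" for i using y[of i] S(1) by (simp add: p_def)
  have "prob (ball z \<epsilon>) > 0" if "z \<in> S" for z
    using that S(2) \<epsilon>(1) by (auto simp: measure_support_def emeasure_eq_measure dest!: subsetD)
  then have p0: "p > 0" unfolding p_def using S(1) y[of 0] by (subst Min_gr_iff) auto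
  have p1: "p \<le> 1" using p_le[of 0] prob_le_1 by (rule order_trans)
  show ?thesis
  proof (intro exI[of _ "D / r"] conjI ballI allI impI)
    show "D / r \<ge> 0" using D r by simp
    fix x and \<eta> :: real
    assume x: "x \<in> shifted_cone K v (D / r)" and \<eta>: "\<eta> > 0"
    obtain \<kappa> where \<kappa>: "\<kappa> \<in> K" "x = \<kappa> + (D / r) *\<^sub>R v" using x by (auto simp: shifted_cone_def)
    have "cball ((D / r) *\<^sub>R v) ((D / r) * r) \<subseteq> K"
      by (rule cball_scaleR_subset_cone[OF K r(2)]) (use D r in simp)
    then have "cball x (0 + D) \<subseteq> K"
      unfolding \<kappa>(2) using \<kappa>(1) r(1) D(1) by (intro cball_add_subset_cone[OF K]) auto
    then have x_deep: "cball x D \<subseteq> K" by simp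
    \<comment> \<open>Apart from \<open>D\<close>, the final distance from the drift line is at most \<open>C\<close> for each step of the first phase.\<close>
    define C where "C = 3 * \<epsilon> + norm (s - mean)"
    have C: "C \<ge> 0" using \<epsilon>(1) by (simp add: C_def)
    \<comment> \<open>The first phase is charged for its displacement \<open>C\<close> and its price \<open>- ln p\<close> per step, and \<open>\<alpha>\<close> keeps both below \<open>\<eta> / 2\<close> per unit of time.\<close>
    define c where "c = 1 + C - ln p"
    have lnp: "ln p \<le> 0" using p0 p1 by simp
    have c: "c > 0" using lnp C by (simp add: c_def)
    define \<alpha> where "\<alpha> = min 1 (\<eta> / (2 * c))"
    have \<alpha>: "\<alpha> > 0" "\<alpha> \<le> 1" using \<eta> c by (auto simp: \<alpha>_def)
    have "\<alpha> * c \<le> \<eta> / (2 * c) * c" using c by (intro mult_right_mono) (auto simp: \<alpha>_def)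
    then have \<alpha>c: "\<alpha> * c \<le> \<eta> / 2" using c by simp
    moreover have "C \<le> c" "- ln p \<le> c" using lnp C by (simp_all add: c_def)
    then have "\<alpha> * C \<le> \<alpha> * c" "\<alpha> * (- ln p) \<le> \<alpha> * c"
      using \<alpha>(1) by (simp_all only: mult_left_mono less_imp_le)
    ultimately have \<alpha>C: "\<alpha> * C \<le> \<eta> / 2" "\<alpha> * (- ln p) \<le> \<eta> / 2" by linarith+
    have ev1: "\<forall>\<^sub>F n in sequentially. D + C \<le> \<eta> / 2 * real n"
      using \<eta> by real_asymp
    have ev2: "\<forall>\<^sub>F n in sequentially. exp (- (\<eta> / 2 * real n)) \<le> p / 2"
      using \<eta> p0 by real_asymp
    show "\<forall>\<^sub>F n in sequentially. exp (- (\<eta> * real n)) \<le> measure (\<Pi>\<^sub>M i\<in>{..<n}. M)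
      {\<xi> \<in> space (\<Pi>\<^sub>M i\<in>{..<n}. M). (\<forall>j\<in>{1..n}. x + (\<Sum>i<j. \<xi> i) \<in> K) \<and>
        norm ((\<Sum>i<n. \<xi> i) - real n *\<^sub>R mean) \<le> \<eta> * real n}"
      using ev1 ev2 eventually_small_fluctuations[OF mult_pos_pos[OF \<epsilon>(1) \<alpha>(1)]]
    proof eventually_elim
      case (elim n)
      \<comment> \<open>The length of the first phase; \<open>\<alpha> \<le> 1\<close> ensures \<open>k \<le> n\<close>.\<close>
      define k where "k = nat \<lceil>\<alpha> * real n\<rceil>"
      have k_ge: "\<alpha> * real n \<le> real k" unfolding k_def by (rule of_nat_ceiling)
      have k_le: "real k \<le> \<alpha> * real n + 1"
        using \<alpha>(1) ceiling_correct[of "\<alpha> * real n"] by (simp add: k_def)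
      have "\<alpha> * real n \<le> real n" using \<alpha> by (simp add: mult_left_le_one_le)
      then have k_n: "k \<le> n" by (simp add: k_def nat_ceiling_le_eq)
      let ?P = "\<Pi>\<^sub>M i\<in>{..<n}. M"
      define G where "G = {\<xi> \<in> space ?P. (\<forall>i<k. \<xi> i \<in> ball (y i) \<epsilon>) \<and>
        (\<forall>j\<in>{k..n}. norm (\<Sum>i=k..<j. \<xi> i - mean) \<le> \<epsilon> * \<alpha> * real n)}"
      define T where "T = {\<xi> \<in> space ?P. (\<forall>j\<in>{1..n}. x + (\<Sum>i<j. \<xi> i) \<in> K) \<and>
        norm ((\<Sum>i<n. \<xi> i) - real n *\<^sub>R mean) \<le> \<eta> * real n}"
      have "exp (- (\<eta> * real n)) = exp (- (\<eta> / 2 * real n)) * exp (- (\<eta> / 2 * real n))"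
        by (simp flip: exp_add)
      also have "\<dots> \<le> exp (- (\<eta> / 2 * real n)) * (p / 2)"
        using elim by (intro mult_left_mono) auto
      also have "\<dots> \<le> exp (\<alpha> * real n * ln p) * (p / 2)"
      proof -
        have "\<alpha> * (- ln p) * real n \<le> \<eta> / 2 * real n" using \<alpha>C by (intro mult_right_mono) auto
        then show ?thesis using p0 by (intro mult_right_mono) (auto simp: algebra_simps)
      qed
      also have "\<dots> = exp ((\<alpha> * real n + 1) * ln p) / 2"
        using p0 by (simp add: distrib_right exp_add)
      also have "\<dots> \<le> exp (real k * ln p) / 2"
        using k_le lnp by (intro divide_right_mono) (auto intro!: mult_right_mono_neg)
      also have "\<dots> = p ^ k / 2" using p0 by (simp add: exp_of_nat_mult)
      also have "\<dots> = (\<Prod>i<k. p) / 2" by simp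
      also have "\<dots> \<le> (\<Prod>i<k. prob (ball (y i) \<epsilon>)) / 2"
        using p0 p_le by (intro divide_right_mono prod_mono) (auto intro: less_imp_le)
      also have "\<dots> \<le> measure ?P G"
        unfolding G_def by (rule elim(3)[rule_format, OF k_n, of "\<lambda>i. ball (y i) \<epsilon>"]) simp
      also have "\<dots> \<le> measure ?P T"
      proof (rule finite_measure.finite_measure_mono)
        show "finite_measure ?P" using prob_space_product by (rule prob_space.finite_measure)
        show "T \<in> sets ?P" unfolding T_def using \<open>closed K\<close> by (rule confined_measurable)
        show "G \<subseteq> T"
        proof
          fix \<xi> assume "\<xi> \<in> G"
          then have sp: "\<xi> \<in> space ?P" and near: "\<And>i. i < k \<Longrightarrow> norm (\<xi> i - y i) \<le> \<epsilon>"
            and fluct: "\<And>j. k \<le> j \<Longrightarrow> j \<le> n \<Longrightarrow> norm (\<Sum>i=k..<j. \<xi> i - mean) \<le> \<epsilon> * \<alpha> * real n"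
            by (auto simp: G_def dist_norm norm_minus_commute intro: less_imp_le)
          have start: "norm ((\<Sum>i<j. \<xi> i) - real j *\<^sub>R s) \<le> D + 2 * \<epsilon> * real j" if "j \<le> k" for j
          proof -
            have "norm ((\<Sum>i<j. \<xi> i) - (\<Sum>i<j. y i)) \<le> (\<Sum>i<j. \<epsilon>)"
              unfolding sum_subtractf[symmetric] using that near by (intro sum_norm_le) auto
            also have "\<dots> = \<epsilon> * real j" by simp
            finally have "norm ((\<Sum>i<j. \<xi> i) - (\<Sum>i<j. y i)) \<le> \<epsilon> * real j" .
            moreover have "norm ((\<Sum>i<j. \<xi> i) - real j *\<^sub>R s) \<le>
                norm ((\<Sum>i<j. \<xi> i) - (\<Sum>i<j. y i)) + norm ((\<Sum>i<j. y i) - real j *\<^sub>R s)"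
              using norm_triangle_ineq[of "(\<Sum>i<j. \<xi> i) - (\<Sum>i<j. y i)" "(\<Sum>i<j. y i) - real j *\<^sub>R s"] by simp
            ultimately show ?thesis using D(2)[of j] by linarith
          qed
          \<comment> \<open>Of the radius \<open>D + 3 * \<epsilon> * j\<close> around \<open>x + j *\<^sub>R s\<close>, the error takes \<open>D + 2 * \<epsilon> * j\<close> and leaves \<open>\<epsilon> * j\<close>.\<close>
          have deep: "cball (x + (\<Sum>i<j. \<xi> i)) (\<epsilon> * real j) \<subseteq> K" if "j \<le> k" for j
          proof -
            have "cball (real j *\<^sub>R s) (real j * (3 * \<epsilon>)) \<subseteq> K"
              by (rule cball_scaleR_subset_cone[OF K \<epsilon>(2)]) simp
            then have "cball (x + real j *\<^sub>R s) (D + real j * (3 * \<epsilon>)) \<subseteq> K"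
              using D(1) \<epsilon>(1) by (intro cball_add_subset_cone[OF K x_deep]) auto
            moreover have "cball (x + (\<Sum>i<j. \<xi> i)) (\<epsilon> * real j) \<subseteq> cball (x + real j *\<^sub>R s) (D + real j * (3 * \<epsilon>))"
              using start[OF that] by (intro cball_subset_cball_iff[THEN iffD2] disjI1) (simp add: dist_norm)
            ultimately show ?thesis by blast
          qed
          have split: "(\<Sum>i<j. \<xi> i) = (\<Sum>i<k. \<xi> i) + real (j - k) *\<^sub>R mean + (\<Sum>i=k..<j. \<xi> i - mean)"
            if "k \<le> j" for j
          proof -
            have "(\<Sum>i<j. \<xi> i) = (\<Sum>i<k. \<xi> i) + (\<Sum>i=k..<j. \<xi> i)"
              using that by (simp add: sum.atLeastLessThan_concat flip: atLeast0LessThan)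
            then show ?thesis by (simp add: sum_subtractf sum_constant_scaleR)
          qed
          have "\<epsilon> * \<alpha> * real n \<le> \<epsilon> * real k"
            using k_ge \<epsilon>(1) by (simp add: mult.assoc)
          then have fluct': "norm (\<Sum>i=k..<j. \<xi> i - mean) \<le> \<epsilon> * real k" if "k \<le> j" "j \<le> n" for j
            using fluct[OF that] by linarith
          have "x + (\<Sum>i<j. \<xi> i) \<in> K" if "j \<le> n" for j
          proof (cases "j \<le> k")
            case True
            then show ?thesis using deep[OF True] \<epsilon>(1) by auto
          next
            case False
            have "cball (real (j - k) *\<^sub>R mean) 0 \<subseteq> K" using convex_cone_scaleR[OF K _ mean] by simp
            then have "cball (x + (\<Sum>i<k. \<xi> i) + real (j - k) *\<^sub>R mean) (\<epsilon> * real k + 0) \<subseteq> K"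
              using \<epsilon>(1) by (intro cball_add_subset_cone[OF K deep]) auto
            moreover have "x + (\<Sum>i<j. \<xi> i) \<in> cball (x + (\<Sum>i<k. \<xi> i) + real (j - k) *\<^sub>R mean) (\<epsilon> * real k + 0)"
              using fluct'[of j] False that by (simp add: split[of j] dist_norm)
            ultimately show ?thesis by blast
          qed
          moreover have "norm ((\<Sum>i<n. \<xi> i) - real n *\<^sub>R mean) \<le> \<eta> * real n"
          proof -
            have "(\<Sum>i<n. \<xi> i) - real n *\<^sub>R mean = ((\<Sum>i<k. \<xi> i) - real k *\<^sub>R s)
                + real k *\<^sub>R (s - mean) + (\<Sum>i=k..<n. \<xi> i - mean)"
              using k_n by (subst split[of n]) (simp_all add: of_nat_diff algebra_simps)
            also have "norm \<dots> \<le> norm ((\<Sum>i<k. \<xi> i) - real k *\<^sub>R s) + norm (real k *\<^sub>R (s - mean))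
                + norm (\<Sum>i=k..<n. \<xi> i - mean)"
              by (intro order_trans[OF norm_triangle_ineq] add_mono norm_triangle_ineq order_refl)
            also have "\<dots> \<le> (D + 2 * \<epsilon> * real k) + real k * norm (s - mean) + \<epsilon> * real k"
              using start[of k] fluct'[of n] k_n by (intro add_mono) auto
            also have "\<dots> = D + C * real k" by (simp add: C_def algebra_simps)
            also have "\<dots> \<le> D + C * (\<alpha> * real n + 1)"
              using k_le C by (intro add_left_mono mult_left_mono) auto
            also have "\<dots> = (D + C) + (\<alpha> * C) * real n" by (simp add: algebra_simps)
            also have "\<dots> \<le> \<eta> / 2 * real n + \<eta> / 2 * real n"
              using elim(1) \<alpha>C(1) by (intro add_mono mult_right_mono) auto
            finally show ?thesis by simp
          qed
          ultimately show "\<xi> \<in> T" using sp by (simp add: T_def)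
        qed
      qed
      finally show ?case unfolding T_def .
    qed
  qed
qed

end

section \<open>Exponential tilting\<close>

lemma PiM_density:
  assumes "prob_space M" "prob_space (density M g)" and [measurable]: "g \<in> borel_measurable M" and "finite I"
  shows "(\<Pi>\<^sub>M i\<in>I. density M g) = density (\<Pi>\<^sub>M i\<in>I. M) (\<lambda>\<xi>. \<Prod>i\<in>I. g (\<xi> i))"
proof -
  interpret M: prob_space M by fact
  interpret N: prob_space "density M g" by fact
  interpret PM: product_sigma_finite "\<lambda>_. M" by standard
  interpret PN: product_sigma_finite "\<lambda>_. density M g" by standard
  have [measurable]: "(\<lambda>\<xi>. \<Prod>i\<in>I. g (\<xi> i)) \<in> borel_measurable (\<Pi>\<^sub>M i\<in>I. M)"
    by (intro borel_measurable_prod_ennreal) measurable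
  have "density (\<Pi>\<^sub>M i\<in>I. M) (\<lambda>\<xi>. \<Prod>i\<in>I. g (\<xi> i)) = (\<Pi>\<^sub>M i\<in>I. density M g)"
  proof (rule PN.PiM_eqI[OF \<open>finite I\<close>])
    show "sets (density (\<Pi>\<^sub>M i\<in>I. M) (\<lambda>\<xi>. \<Prod>i\<in>I. g (\<xi> i))) = sets (\<Pi>\<^sub>M i\<in>I. density M g)"
      unfolding sets_density by (rule sets_PiM_cong) auto
    fix A assume A: "\<And>i. i \<in> I \<Longrightarrow> A i \<in> sets (density M g)"
    then have A': "\<And>i. i \<in> I \<Longrightarrow> A i \<in> sets M" by simp
    have "emeasure (density (\<Pi>\<^sub>M i\<in>I. M) (\<lambda>\<xi>. \<Prod>i\<in>I. g (\<xi> i))) (Pi\<^sub>E I A) =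
        (\<integral>\<^sup>+\<xi>. (\<Prod>i\<in>I. g (\<xi> i)) * indicator (Pi\<^sub>E I A) \<xi> \<partial>(\<Pi>\<^sub>M i\<in>I. M))"
      using A' \<open>finite I\<close> by (intro emeasure_density) (auto intro!: sets_PiM_I_finite)
    also have "\<dots> = (\<integral>\<^sup>+\<xi>. (\<Prod>i\<in>I. g (\<xi> i) * indicator (A i) (\<xi> i)) \<partial>(\<Pi>\<^sub>M i\<in>I. M))"
    proof (rule nn_integral_cong)
      fix \<xi> assume "\<xi> \<in> space (\<Pi>\<^sub>M i\<in>I. M)"
      then have ext: "\<xi> \<in> extensional I" by (simp add: space_PiM PiE_iff)
      show "(\<Prod>i\<in>I. g (\<xi> i)) * indicator (Pi\<^sub>E I A) \<xi> = (\<Prod>i\<in>I. g (\<xi> i) * indicator (A i) (\<xi> i))"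
      proof (cases "\<xi> \<in> Pi\<^sub>E I A")
        case True
        then show ?thesis by (auto simp: PiE_iff intro!: prod.cong)
      next
        case False
        then obtain i where "i \<in> I" "\<xi> i \<notin> A i" using ext by (auto simp: PiE_iff)
        then have "(\<Prod>i\<in>I. g (\<xi> i) * indicator (A i) (\<xi> i)) = 0"
          using \<open>finite I\<close> by (intro prod_zero bexI[of _ i]) auto
        then show ?thesis using False by simp
      qed
    qed
    also have "\<dots> = (\<Prod>i\<in>I. \<integral>\<^sup>+y. g y * indicator (A i) y \<partial>M)"
      using A' \<open>finite I\<close> by (intro PM.product_nn_integral_prod) auto
    also have "\<dots> = (\<Prod>i\<in>I. emeasure (density M g) (A i))"
      using A' by (intro prod.cong refl) (simp add: emeasure_density)
    finally show "emeasure (density (\<Pi>\<^sub>M i\<in>I. M) (\<lambda>\<xi>. \<Prod>i\<in>I. g (\<xi> i))) (Pi\<^sub>E I A) = 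
      (\<Prod>i\<in>I. emeasure (density M g) (A i))" .
  qed
  then show ?thesis by simp
qed

text \<open>
  For \<open>u = x\<^sup>*\<close> this is the setting of the theorem without the cone.
\<close>

locale tilting = prob_space \<mu> for \<mu> :: "'a::euclidean_space measure" +
  fixes V :: "'a set" and u :: 'a
  assumes sets_\<mu>[measurable_cong, simp]: "sets \<mu> = sets borel"
    and V: "open V" "u \<in> V" "\<And>z. z \<in> V \<Longrightarrow> laplace_transform \<mu> z < \<infinity>"

begin

definition L :: real where "L = enn2real (laplace_transform \<mu> u)"

lemma laplace_eq: "laplace_transform \<mu> u = ennreal L"
  using V(2,3) by (auto simp: L_def)

lemma L_pos: "L > 0"
proof -
  have "laplace_transform \<mu> u \<noteq> 0"
  proof
    assume "laplace_transform \<mu> u = 0"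
    then have "AE y in \<mu>. ennreal (exp (u \<bullet> y)) = 0"
      unfolding laplace_transform_def by (subst (asm) nn_integral_0_iff_AE) auto
    then have "AE y in \<mu>. False" by eventually_elim (simp add: ennreal_eq_0_iff)
    then show False by simp
  qed
  moreover have "L \<ge> 0" by (simp add: L_def)
  ultimately show ?thesis using laplace_eq by (cases "L = 0") auto
qed

definition tilted :: "'a measure" where
  "tilted = density \<mu> (\<lambda>y. ennreal (exp (u \<bullet> y) / L))"

text \<open>
  The Laplace transform of the tilted law is that of \<open>\<mu>\<close>, translated by \<open>u\<close> and normalised. All moment
  properties of the tilted law are read off from this.
\<close>

lemma laplace_shift:
  "laplace_transform \<mu> (u + z) = ennreal L * (\<integral>\<^sup>+y. ennreal (exp (z \<bullet> y)) \<partial>tilted)"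
proof -
  have "ennreal L * (\<integral>\<^sup>+y. ennreal (exp (z \<bullet> y)) \<partial>tilted) =
      ennreal L * (\<integral>\<^sup>+y. ennreal (exp (u \<bullet> y) / L) * ennreal (exp (z \<bullet> y)) \<partial>\<mu>)"
    unfolding tilted_def by (subst nn_integral_density) auto
  also have "\<dots> = (\<integral>\<^sup>+y. ennreal L * (ennreal (exp (u \<bullet> y) / L) * ennreal (exp (z \<bullet> y))) \<partial>\<mu>)"
    by (rule nn_integral_cmult[symmetric]) measurable
  also have "\<dots> = (\<integral>\<^sup>+y. ennreal (exp ((u + z) \<bullet> y)) \<partial>\<mu>)"
    using L_pos by (intro nn_integral_cong) (simp add: inner_add_left exp_add flip: ennreal_mult)
  finally show ?thesis by (simp add: laplace_transform_def)
qed

lemma prob_space_tilted: "prob_space tilted"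
proof (rule prob_spaceI)
  have "ennreal L * emeasure tilted (space tilted) = ennreal L"
    using laplace_shift[of 0] laplace_eq by simp
  then have "ennreal (1 / L) * (ennreal L * emeasure tilted (space tilted)) = ennreal (1 / L) * ennreal L"
    by simp
  then show "emeasure tilted (space tilted) = 1"
    using L_pos by (simp add: mult.assoc[symmetric] flip: ennreal_mult)
qed

text \<open>
  As \<open>V\<close> is open, it contains \<open>u + t *\<^sub>R w\<close> and \<open>u - t *\<^sub>R w\<close> for small \<open>t\<close>, and
  \<open>exp (t * \<bar>w \<bullet> y\<bar>)\<close> is at most the sum of the two exponentials.
\<close>

lemma exponential_moments_tilted: "exponential_moments tilted"
proof -
  interpret T: prob_space tilted by (rule prob_space_tilted)
  show ?thesis
  proof unfold_locales
    show "sets tilted = sets borel" by (simp add: tilted_def)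
    fix w :: 'a
    obtain e where e: "e > 0" "ball u e \<subseteq> V" using V open_contains_ball by blast
    define t where "t = e / (2 * (norm w + 1))"
    have nw: "norm w + 1 > 0" by (simp add: add_nonneg_pos)
    have t: "t > 0" using e nw by (simp add: t_def)
    have "t * norm w \<le> t * (norm w + 1)" using t by simp
    also have "t * (norm w + 1) = e / 2" using nw by (simp add: t_def field_simps)
    also have "\<dots> < e" using e by simp
    finally have "t * norm w < e" .
    then have "u + t *\<^sub>R w \<in> V" "u + (- t) *\<^sub>R w \<in> V"
      using e t by (auto simp: dist_norm intro!: subsetD[OF e(2)])
    then have fin: "laplace_transform \<mu> (u + t *\<^sub>R w) < \<infinity>" "laplace_transform \<mu> (u + (- t) *\<^sub>R w) < \<infinity>"
      using V(3) by blast+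
    have fin': "(\<integral>\<^sup>+y. ennreal (exp (z \<bullet> y)) \<partial>tilted) < \<infinity>" if "laplace_transform \<mu> (u + z) < \<infinity>" for z
      using that L_pos unfolding laplace_shift by (auto simp: ennreal_mult_less_top)
    have "integrable tilted (\<lambda>y. exp (t * \<bar>w \<bullet> y\<bar>))"
    proof (rule integrableI_nonneg)
      have "(\<integral>\<^sup>+y. ennreal (exp (t * \<bar>w \<bullet> y\<bar>)) \<partial>tilted) \<le>
          (\<integral>\<^sup>+y. ennreal (exp ((t *\<^sub>R w) \<bullet> y)) + ennreal (exp (((- t) *\<^sub>R w) \<bullet> y)) \<partial>tilted)"
        by (intro nn_integral_mono) (auto simp: abs_if simp flip: ennreal_plus)
      also have "\<dots> = (\<integral>\<^sup>+y. ennreal (exp ((t *\<^sub>R w) \<bullet> y)) \<partial>tilted) +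
          (\<integral>\<^sup>+y. ennreal (exp (((- t) *\<^sub>R w) \<bullet> y)) \<partial>tilted)"
        by (rule nn_integral_add) (simp_all add: tilted_def)
      also have "\<dots> < \<infinity>" using fin[THEN fin'] by (simp add: less_top[symmetric])
      finally show "(\<integral>\<^sup>+y. ennreal (exp (t * \<bar>w \<bullet> y\<bar>)) \<partial>tilted) < \<infinity>" .
    qed (simp_all add: tilted_def)
    with t show "\<exists>t>0. integrable tilted (\<lambda>y. exp (t * \<bar>w \<bullet> y\<bar>))" by blast
  qed
qed

sublocale T: exponential_moments tilted
  by (rule exponential_moments_tilted)

lemma AE_tilted_iff: "(AE y in tilted. P y) \<longleftrightarrow> (AE y in \<mu>. P y)"
  unfolding tilted_def using L_pos by (subst AE_density) (auto simp: ennreal_less_zero_iff)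

text \<open>
  The first-order condition at a constrained minimum: were \<open>z \<bullet> mean\<close> negative, the Laplace transform
  would fall strictly below its value at \<open>u\<close> for some small \<open>t\<close>.
\<close>

lemma feasible_direction_inner_mean_nonneg:
  assumes "t1 > 0" and min: "\<And>t. 0 < t \<Longrightarrow> t \<le> t1 \<Longrightarrow> laplace_transform \<mu> u \<le> laplace_transform \<mu> (u + t *\<^sub>R z)"
  shows "z \<bullet> T.mean \<ge> 0"
proof (rule ccontr)
  assume "\<not> z \<bullet> T.mean \<ge> 0"
  then obtain t where t: "0 < t" "t \<le> t1" "integrable tilted (\<lambda>y. exp (t * (z \<bullet> y - 0)))"
    "(\<integral>y. exp (t * (z \<bullet> y - 0)) \<partial>tilted) < 1"
    using T.exp_integral_inner_less_1[of z 0 t1] assms(1) by auto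
  have "ennreal L \<le> ennreal L * (\<integral>\<^sup>+y. ennreal (exp ((t *\<^sub>R z) \<bullet> y)) \<partial>tilted)"
    using min[OF t(1,2)] unfolding laplace_shift laplace_eq by simp
  also have "(\<integral>\<^sup>+y. ennreal (exp ((t *\<^sub>R z) \<bullet> y)) \<partial>tilted) = ennreal (\<integral>y. exp (t * (z \<bullet> y - 0)) \<partial>tilted)"
    using t(3) by (subst nn_integral_eq_integral[symmetric]) auto
  also have "ennreal L * \<dots> = ennreal (L * (\<integral>y. exp (t * (z \<bullet> y - 0)) \<partial>tilted))"
    using L_pos by (simp add: ennreal_mult')
  finally have "L \<le> L * (\<integral>y. exp (t * (z \<bullet> y - 0)) \<partial>tilted)"
    using L_pos by (subst (asm) ennreal_le_iff) (auto intro!: mult_nonneg_nonneg)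
  then show False using t(4) L_pos by simp
qed

text \<open>
  The density of the tilted path law is \<open>exp (u \<bullet> W\<^sub>n) / L ^ n\<close>, so events on which \<open>u \<bullet> W\<^sub>n\<close> is
  bounded transfer back to \<open>\<mu>\<close>.
\<close>

lemma tilted_prob_le:
  assumes A: "A \<in> sets (\<Pi>\<^sub>M i\<in>{..<n}. \<mu>)"
    and bound: "\<And>\<xi>. \<xi> \<in> A \<Longrightarrow> u \<bullet> (\<Sum>i<n. \<xi> i) \<le> c"
  shows "L ^ n * exp (- c) * measure (\<Pi>\<^sub>M i\<in>{..<n}. tilted) A \<le> measure (\<Pi>\<^sub>M i\<in>{..<n}. \<mu>) A"
proof -
  let ?P = "\<Pi>\<^sub>M i\<in>{..<n}. \<mu>" and ?T = "\<Pi>\<^sub>M i\<in>{..<n}. tilted"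
  let ?g = "\<lambda>y. ennreal (exp (u \<bullet> y) / L)"
  interpret P: prob_space ?P by (intro prob_space_PiM prob_space_axioms)
  interpret PT: prob_space ?T by (rule T.prob_space_product)
  have T_eq: "?T = density ?P (\<lambda>\<xi>. \<Prod>i<n. ?g (\<xi> i))"
    unfolding tilted_def
    by (rule PiM_density) (use prob_space_axioms prob_space_tilted in \<open>simp_all add: tilted_def\<close>)
  have [measurable]: "(\<lambda>\<xi>. \<Prod>i<n. ?g (\<xi> i)) \<in> borel_measurable ?P"
  proof (rule borel_measurable_prod_ennreal)
    fix i assume "i \<in> {..<n}"
    then show "(\<lambda>\<xi>. ?g (\<xi> i)) \<in> borel_measurable ?P"
      by (rule measurable_compose[OF measurable_component_singleton]) simp
  qed
  have "emeasure ?T A = (\<integral>\<^sup>+\<xi>. (\<Prod>i<n. ?g (\<xi> i)) * indicator A \<xi> \<partial>?P)"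
    unfolding T_eq using A by (intro emeasure_density) auto
  also have "\<dots> \<le> (\<integral>\<^sup>+\<xi>. ennreal (exp c / L ^ n) * indicator A \<xi> \<partial>?P)"
  proof (rule nn_integral_mono)
    fix \<xi>
    show "(\<Prod>i<n. ?g (\<xi> i)) * indicator A \<xi> \<le> ennreal (exp c / L ^ n) * indicator A \<xi>"
    proof (cases "\<xi> \<in> A")
      case True
      have "(\<Prod>i<n. ?g (\<xi> i)) = ennreal (exp (u \<bullet> (\<Sum>i<n. \<xi> i)) / L ^ n)"
        using L_pos by (simp add: prod_ennreal prod_dividef exp_sum inner_sum_right)
      also have "\<dots> \<le> ennreal (exp c / L ^ n)"
        using bound[OF True] L_pos by (intro ennreal_leI divide_right_mono) auto
      finally show ?thesis using True by simp
    qed simp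
  qed
  also have "\<dots> = ennreal (exp c / L ^ n) * emeasure ?P A"
    using A by (rule nn_integral_cmult_indicator)
  finally have "measure ?T A \<le> exp c / L ^ n * measure ?P A"
    using L_pos by (simp add: P.emeasure_eq_measure PT.emeasure_eq_measure flip: ennreal_mult)
  then have "L ^ n * exp (- c) * measure ?T A \<le> L ^ n * exp (- c) * (exp c / L ^ n * measure ?P A)"
    using L_pos by (intro mult_left_mono) auto
  also have "\<dots> = measure ?P A" using L_pos by (simp add: exp_minus)
  finally show ?thesis .
qed

end

section \<open>Exit times and exponential rates\<close>

lemma enat_less_exit_time_iff: "enat n < exit_time K S \<longleftrightarrow> (\<forall>j\<in>{1..n}. S j \<in> K)"
proof
  assume *: "enat n < exit_time K S"
  show "\<forall>j\<in>{1..n}. S j \<in> K"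
  proof (rule ccontr)
    assume "\<not> ?thesis"
    then obtain j where j: "1 \<le> j" "j \<le> n" "S j \<notin> K" by auto
    then have "exit_time K S \<le> enat j" unfolding exit_time_def by (intro Inf_lower) auto
    with * j(2) show False by (meson enat_ord_simps(1) leD order_trans)
  qed
next
  assume *: "\<forall>j\<in>{1..n}. S j \<in> K"
  have "enat (Suc n) \<le> exit_time K S"
    unfolding exit_time_def using * by (intro Inf_greatest) (auto simp: not_less_eq_eq[symmetric])
  then show "enat n < exit_time K S"
    by (meson enat_ord_simps(2) lessI order_less_le_trans)
qed

text \<open>
  Staying in \<open>K\<close> up to time \<open>n\<close> involves only the first \<open>n\<close> increments, so the infinite product may be
  replaced by a finite one, where Tonelli's theorem and densities are available.
\<close>

lemma prob_exit_time_greater: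
  fixes \<mu> :: "'a::euclidean_space measure"
  assumes "prob_space \<mu>" and sets[measurable_cong]: "sets \<mu> = sets borel" and "closed K"
  shows "\<P>(S in random_walk_law \<mu> x. exit_time K S > enat n) =
    measure (\<Pi>\<^sub>M i\<in>{..<n}. \<mu>) {\<xi> \<in> space (\<Pi>\<^sub>M i\<in>{..<n}. \<mu>). \<forall>j\<in>{1..n}. x + (\<Sum>i<j. \<xi> i) \<in> K}"
proof -
  let ?P = "\<Pi>\<^sub>M i\<in>(UNIV::nat set). \<mu>" and ?Q = "\<Pi>\<^sub>M i\<in>(UNIV::nat set). (borel :: 'a measure)"
  let ?R = "\<Pi>\<^sub>M i\<in>{..<n}. \<mu>"
  let ?walk = "\<lambda>\<xi> n. x + (\<Sum>i<n. \<xi> i)"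
  interpret PP: product_prob_space "\<lambda>_::nat. \<mu>" UNIV
    by (rule product_prob_spaceI) (rule assms(1))
  have K[measurable]: "K \<in> sets borel" using assms(3) by simp
  have walk[measurable]: "?walk \<in> ?P \<rightarrow>\<^sub>M ?Q"
    by (rule measurable_PiM_single') auto
  have B[measurable]: "{S \<in> space ?Q. \<forall>j\<in>{1..n}. S j \<in> K} \<in> sets ?Q" by measurable
  define A where "A = {\<xi> \<in> space ?R. \<forall>j\<in>{1..n}. x + (\<Sum>i<j. \<xi> i) \<in> K}"
  have A[measurable]: "A \<in> sets ?R"
    unfolding A_def by (rule staying_measurable[OF sets \<open>closed K\<close>])
  have "\<P>(S in random_walk_law \<mu> x. exit_time K S > enat n) =
      measure (distr ?P ?Q ?walk) {S \<in> space ?Q. \<forall>j\<in>{1..n}. S j \<in> K}"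
    by (simp add: random_walk_law_def enat_less_exit_time_iff)
  also have "\<dots> = measure ?P (?walk -` {S \<in> space ?Q. \<forall>j\<in>{1..n}. S j \<in> K} \<inter> space ?P)"
    by (rule measure_distr) measurable
  also have "?walk -` {S \<in> space ?Q. \<forall>j\<in>{1..n}. S j \<in> K} \<inter> space ?P =
      (\<lambda>\<xi>. restrict \<xi> {..<n}) -` A \<inter> space ?P"
    by (auto simp: A_def space_PiM PiE_iff sets_eq_imp_space_eq[OF sets])
  also have "measure ?P \<dots> = measure (distr ?P ?R (\<lambda>\<xi>. restrict \<xi> {..<n})) A"
    by (rule measure_distr[symmetric]) (auto intro!: measurable_restrict_subset)
  also have "distr ?P ?R (\<lambda>\<xi>. restrict \<xi> {..<n}) = ?R"
    by (rule PP.distr_PiM_restrict_finite) auto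
  finally show ?thesis by (simp add: A_def)
qed

lemma exp_sum_inner_eq_prod:
  fixes \<xi> :: "nat \<Rightarrow> 'a::real_inner"
  shows "(\<Prod>i<n. ennreal (exp (u \<bullet> \<xi> i))) = ennreal (exp (u \<bullet> (\<Sum>i<n. \<xi> i)))"
  by (simp add: prod_ennreal exp_sum inner_sum_right)

lemma prob_stay_le:
  fixes \<mu> :: "'a::euclidean_space measure"
  assumes "prob_space \<mu>" and sets[measurable_cong]: "sets \<mu> = sets borel"
    and "closed K" and "u \<in> dual_cone K" and fin: "laplace_transform \<mu> u < \<infinity>" and "n \<ge> 1"
  shows "measure (\<Pi>\<^sub>M i\<in>{..<n}. \<mu>) {\<xi> \<in> space (\<Pi>\<^sub>M i\<in>{..<n}. \<mu>). \<forall>j\<in>{1..n}. x + (\<Sum>i<j. \<xi> i) \<in> K}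
    \<le> exp (u \<bullet> x) * enn2real (laplace_transform \<mu> u) ^ n"
proof -
  interpret prob_space \<mu> by fact
  interpret PM: product_sigma_finite "\<lambda>_. \<mu>" by standard
  let ?P = "\<Pi>\<^sub>M i\<in>{..<n}. \<mu>"
  define A where "A = {\<xi> \<in> space ?P. \<forall>j\<in>{1..n}. x + (\<Sum>i<j. \<xi> i) \<in> K}"
  define L where "L = enn2real (laplace_transform \<mu> u)"
  have L: "laplace_transform \<mu> u = ennreal L" "L \<ge> 0"
    using fin by (auto simp: L_def)
  have A: "A \<in> sets ?P" unfolding A_def by (rule staying_measurable[OF sets \<open>closed K\<close>])
  have "emeasure ?P A = (\<integral>\<^sup>+\<xi>. indicator A \<xi> \<partial>?P)"
    using nn_integral_indicator[OF A] by (rule sym)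
  also have "\<dots> \<le> (\<integral>\<^sup>+\<xi>. ennreal (exp (u \<bullet> x)) * (\<Prod>i<n. ennreal (exp (u \<bullet> \<xi> i))) \<partial>?P)"
  proof (rule nn_integral_mono)
    fix \<xi>
    show "indicator A \<xi> \<le> ennreal (exp (u \<bullet> x)) * (\<Prod>i<n. ennreal (exp (u \<bullet> \<xi> i)))"
    proof (cases "\<xi> \<in> A")
      case True
      then have "x + (\<Sum>i<n. \<xi> i) \<in> K" using \<open>n \<ge> 1\<close> by (auto simp: A_def)
      then have "u \<bullet> (x + (\<Sum>i<n. \<xi> i)) \<ge> 0"
        using \<open>u \<in> dual_cone K\<close> by (subst inner_commute) (simp add: dual_cone_def)
      then show ?thesis unfolding exp_sum_inner_eq_prod using True
        by (simp add: inner_add_right flip: ennreal_mult exp_add)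
    qed simp
  qed
  also have "\<dots> = ennreal (exp (u \<bullet> x)) * (\<integral>\<^sup>+\<xi>. (\<Prod>i<n. ennreal (exp (u \<bullet> \<xi> i))) \<partial>?P)"
  proof (rule nn_integral_cmult, rule borel_measurable_prod_ennreal)
    fix i assume "i \<in> {..<n}"
    then show "(\<lambda>\<xi>. ennreal (exp (u \<bullet> \<xi> i))) \<in> borel_measurable ?P"
      by (rule measurable_compose[OF measurable_component_singleton]) measurable
  qed
  also have "(\<integral>\<^sup>+\<xi>. (\<Prod>i<n. ennreal (exp (u \<bullet> \<xi> i))) \<partial>?P) = (\<Prod>i<n. \<integral>\<^sup>+y. ennreal (exp (u \<bullet> y)) \<partial>\<mu>)"
    by (rule PM.product_nn_integral_prod) auto
  also have "\<dots> = ennreal (L ^ n)"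
    using L by (simp add: laplace_transform_def ennreal_power)
  also have "ennreal (exp (u \<bullet> x)) * ennreal (L ^ n) = ennreal (exp (u \<bullet> x) * L ^ n)"
    using L by (simp add: ennreal_mult)
  finally have "measure ?P A \<le> exp (u \<bullet> x) * L ^ n"
    unfolding measure_def using L by (intro enn2real_leI) auto
  then show ?thesis by (simp add: A_def L_def)
qed

lemma tendsto_nth_root_exponential_rate:
  fixes q :: "nat \<Rightarrow> real"
  assumes "L > 0" and upper: "\<forall>\<^sub>F n in sequentially. q n \<le> C * L ^ n" and "C > 0"
    and lower: "\<And>\<eta>. \<eta> > 0 \<Longrightarrow> \<forall>\<^sub>F n in sequentially. L ^ n * exp (- (\<eta> * real n)) \<le> q n"
    and "\<And>n. q n \<ge> 0"
  shows "(\<lambda>n. q n powr (1 / real n)) \<longlonglongrightarrow> L"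
proof (rule order_tendstoI)
  fix b assume b: "L < b"
  have "(\<lambda>n. C powr (1 / real n) * L) \<longlonglongrightarrow> C powr 0 * L"
    using \<open>C > 0\<close> by (intro tendsto_intros lim_const_over_n) auto
  then have "\<forall>\<^sub>F n in sequentially. C powr (1 / real n) * L < b"
    using b \<open>C > 0\<close> by (intro order_tendstoD(2)[of _ L]) auto
  then show "\<forall>\<^sub>F n in sequentially. q n powr (1 / real n) < b"
    using upper eventually_gt_at_top[of 0]
  proof eventually_elim
    case (elim n)
    have "q n powr (1 / real n) \<le> (C * L ^ n) powr (1 / real n)"
      using elim assms(5) by (intro powr_mono2) auto
    also have "\<dots> = C powr (1 / real n) * (L ^ n) powr (1 / real n)"
      by (rule powr_mult)
    also have "(L ^ n) powr (1 / real n) = L"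
      using elim \<open>L > 0\<close> by (simp add: powr_powr flip: powr_realpow)
    finally show ?case using elim by simp
  qed
next
  fix a assume a: "a < L"
  obtain \<eta> where \<eta>: "\<eta> > 0" "L * exp (- \<eta>) > a"
  proof (cases "a > 0")
    case True
    have "ln (a / L) < 0" using True a by simp
    moreover have "L * exp (ln (a / L) / 2) > L * exp (ln (a / L))"
      using calculation \<open>L > 0\<close> by (intro mult_strict_left_mono) auto
    ultimately show ?thesis using True \<open>L > 0\<close> by (intro that[of "- ln (a / L) / 2"]) auto
  next
    case False
    then have "a < L * exp (- 1)" using \<open>L > 0\<close> by (intro le_less_trans[of a 0]) auto
    then show ?thesis by (intro that[of 1]) auto
  qed
  show "\<forall>\<^sub>F n in sequentially. a < q n powr (1 / real n)"
    using lower[OF \<eta>(1)] eventually_gt_at_top[of 0]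
  proof eventually_elim
    case (elim n)
    have "L * exp (- \<eta>) = (L ^ n * exp (- (\<eta> * real n))) powr (1 / real n)"
    proof -
      have "L ^ n * exp (- (\<eta> * real n)) = (L * exp (- \<eta>)) ^ n"
        by (simp add: power_mult_distrib mult.commute flip: exp_of_nat_mult)
      then show ?thesis using elim \<open>L > 0\<close> by (simp add: powr_powr flip: powr_realpow)
    qed
    also have "\<dots> \<le> q n powr (1 / real n)"
      using elim \<open>L > 0\<close> by (intro powr_mono2) auto
    finally show ?case using \<eta>(2) by simp
  qed
qed

section \<open>The exponential decay rate of the survival probability\<close>

theorem theorem1:
  fixes K V :: "(real ^ 'd) set" and v xstar :: "real ^ 'd" and \<mu> :: "(real ^ 'd) measure"
  assumes "closed K" and "convex_cone K" and "interior K \<noteq> {}"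
    and "v \<in> interior K"
    and "prob_space \<mu>" and "sets \<mu> = sets borel"
    and not_in_hyperplane:
      "\<And>a. a \<noteq> 0 \<Longrightarrow> \<not> measure_support \<mu> \<subseteq> {y. a \<bullet> y = 0}"
    and "xstar \<in> dual_cone K" and "open V" and "xstar \<in> V"
    and "\<And>x. x \<in> V \<Longrightarrow> laplace_transform \<mu> x < \<infinity>"
    and xstar_minimum:
      "\<And>x. x \<in> dual_cone K \<inter> V \<Longrightarrow> laplace_transform \<mu> xstar \<le> laplace_transform \<mu> x"
  shows "\<exists>\<delta>\<ge>0. \<forall>x \<in> shifted_cone K v \<delta>.
    (\<lambda>n. \<P>(S in random_walk_law \<mu> x. exit_time K S > enat n) powr (1 / real n))
      \<longlonglongrightarrow> enn2real (laplace_transform \<mu> xstar)"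
proof -
  interpret tilting \<mu> V xstar
    using assms by (auto simp: tilting_def tilting_axioms_def)
  obtain e where e: "e > 0" "ball xstar e \<subseteq> V"
    using \<open>open V\<close> \<open>xstar \<in> V\<close> open_contains_ball by blast
  have feasible: "z \<bullet> T.mean \<ge> 0"
    if dir: "\<And>t. 0 < t \<Longrightarrow> t \<le> 1 \<Longrightarrow> xstar + t *\<^sub>R z \<in> dual_cone K" for z
  proof (rule feasible_direction_inner_mean_nonneg)
    have nz: "norm z + 1 > 0" by (simp add: add_nonneg_pos)
    define t1 where "t1 = min 1 (e / (2 * (norm z + 1)))"
    show "t1 > 0" using e nz by (simp add: t1_def)
    fix t assume t: "0 < t" "t \<le> t1"
    have "t * norm z \<le> t * (norm z + 1)" using t by simp
    also have "\<dots> \<le> e / (2 * (norm z + 1)) * (norm z + 1)"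
      using t nz by (intro mult_right_mono) (auto simp: t1_def)
    also have "\<dots> = e / 2" using nz by (simp add: field_simps)
    also have "\<dots> < e" using e by simp
    finally have "xstar + t *\<^sub>R z \<in> V" using t e(2) by (auto simp: dist_norm intro!: subsetD[OF e(2)])
    moreover have "xstar + t *\<^sub>R z \<in> dual_cone K" using t by (intro dir) (auto simp: t1_def)
    ultimately show "laplace_transform \<mu> xstar \<le> laplace_transform \<mu> (xstar + t *\<^sub>R z)"
      by (intro xstar_minimum) blast
  qed
  have mean_K: "T.mean \<in> K"
  proof (rule bidual_cone_subset[OF assms(1,2)])
    fix z assume "z \<in> dual_cone K"
    then show "z \<bullet> T.mean \<ge> 0"
      using \<open>xstar \<in> dual_cone K\<close> by (intro feasible) (auto simp: dual_cone_def inner_add_right)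
  qed
  have "(- xstar) \<bullet> T.mean \<ge> 0"
  proof (rule feasible)
    fix t :: real assume t: "0 < t" "t \<le> 1"
    \<comment> \<open>The dual cone is a cone, so one may move from \<open>xstar\<close> towards the apex.\<close>
    have "xstar + t *\<^sub>R (- xstar) = (1 - t) *\<^sub>R xstar" by (simp add: algebra_simps)
    then show "xstar + t *\<^sub>R (- xstar) \<in> dual_cone K"
      using t \<open>xstar \<in> dual_cone K\<close> by (simp add: dual_cone_def)
  qed
  then have drift: "xstar \<bullet> T.mean \<le> 0" by simp
  have nondeg: "\<not> (AE y in tilted. a \<bullet> y = 0)" if "a \<noteq> 0" for a
  proof
    assume "AE y in tilted. a \<bullet> y = 0"
    then have "measure_support \<mu> \<subseteq> {y. a \<bullet> y = 0}"
      by (intro measure_support_subset_closed) (auto simp: AE_tilted_iff closed_hyperplane)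
    with not_in_hyperplane[OF that] show False ..
  qed
  obtain \<delta> where \<delta>: "\<delta> \<ge> 0" and stay: "\<And>x \<eta>. x \<in> shifted_cone K v \<delta> \<Longrightarrow> \<eta> > 0 \<Longrightarrow>
    \<forall>\<^sub>F n in sequentially. exp (- (\<eta> * real n)) \<le> measure (\<Pi>\<^sub>M i\<in>{..<n}. tilted)
      {\<xi> \<in> space (\<Pi>\<^sub>M i\<in>{..<n}. tilted). (\<forall>j\<in>{1..n}. x + (\<Sum>i<j. \<xi> i) \<in> K) \<and>
        norm ((\<Sum>i<n. \<xi> i) - real n *\<^sub>R T.mean) \<le> \<eta> * real n}"
    using T.eventually_confined[OF assms(1,2,4) mean_K nondeg] by blast
  show ?thesis
  proof (intro exI[of _ \<delta>] conjI ballI \<delta>)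
    fix x assume x: "x \<in> shifted_cone K v \<delta>"
    define q where "q n = measure (\<Pi>\<^sub>M i\<in>{..<n}. \<mu>)
      {\<xi> \<in> space (\<Pi>\<^sub>M i\<in>{..<n}. \<mu>). \<forall>j\<in>{1..n}. x + (\<Sum>i<j. \<xi> i) \<in> K}" for n :: nat
    have "(\<lambda>n. q n powr (1 / real n)) \<longlonglongrightarrow> L"
    proof (rule tendsto_nth_root_exponential_rate)
      show "L > 0" by (rule L_pos)
      show "\<forall>\<^sub>F n in sequentially. q n \<le> exp (xstar \<bullet> x) * L ^ n"
        using eventually_ge_at_top[of 1]
      proof eventually_elim
        case (elim n)
        then show ?case unfolding q_def L_def using assms by (intro prob_stay_le) auto
      qed
      show "exp (xstar \<bullet> x) > 0" by simp
      show "q n \<ge> 0" for n by (simp add: q_def)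
      fix \<eta> :: real assume \<eta>: "\<eta> > 0"
      \<comment> \<open>The tilt costs \<open>norm xstar * \<beta>\<close> and staying costs \<open>\<beta>\<close> per step.\<close>
      define \<beta> where "\<beta> = \<eta> / (norm xstar + 1)"
      have nx: "norm xstar + 1 > 0" by (simp add: add_nonneg_pos)
      have \<beta>: "\<beta> > 0" "(norm xstar + 1) * \<beta> = \<eta>" using \<eta> nx by (auto simp: \<beta>_def)
      show "\<forall>\<^sub>F n in sequentially. L ^ n * exp (- (\<eta> * real n)) \<le> q n"
        using stay[OF x \<beta>(1)]
      proof eventually_elim
        case (elim n)
        let ?P = "\<Pi>\<^sub>M i\<in>{..<n}. \<mu>" and ?T = "\<Pi>\<^sub>M i\<in>{..<n}. tilted"
        interpret P: prob_space ?P by (intro prob_space_PiM prob_space_axioms)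
        define A where "A = {\<xi> \<in> space ?T. (\<forall>j\<in>{1..n}. x + (\<Sum>i<j. \<xi> i) \<in> K) \<and>
          norm ((\<Sum>i<n. \<xi> i) - real n *\<^sub>R T.mean) \<le> \<beta> * real n}"
        have sets_eq: "sets ?T = sets ?P" by (rule sets_PiM_cong) (auto simp: tilted_def)
        have A: "A \<in> sets ?P"
          using T.confined_measurable[OF assms(1)] unfolding A_def sets_eq[symmetric] .
        have B: "{\<xi> \<in> space ?P. \<forall>j\<in>{1..n}. x + (\<Sum>i<j. \<xi> i) \<in> K} \<in> sets ?P"
          by (rule staying_measurable[OF sets_\<mu> assms(1)])
        have "L ^ n * exp (- (\<eta> * real n)) = L ^ n * exp (- (norm xstar * \<beta> * real n)) * exp (- (\<beta> * real n))"
          by (simp add: algebra_simps flip: \<beta>(2) exp_add)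
        also have "\<dots> \<le> L ^ n * exp (- (norm xstar * \<beta> * real n)) * measure ?T A"
          using elim L_pos unfolding A_def by (intro mult_left_mono) auto
        also have "\<dots> \<le> measure ?P A"
        proof (rule tilted_prob_le[OF A])
          fix \<xi> assume "\<xi> \<in> A"
          then have "norm ((\<Sum>i<n. \<xi> i) - real n *\<^sub>R T.mean) \<le> \<beta> * real n" by (simp add: A_def)
          then have "xstar \<bullet> ((\<Sum>i<n. \<xi> i) - real n *\<^sub>R T.mean) \<le> norm xstar * (\<beta> * real n)"
            by (intro order_trans[OF norm_cauchy_schwarz] mult_left_mono) auto
          moreover have "real n * (xstar \<bullet> T.mean) \<le> 0" using drift by (simp add: mult_nonneg_nonpos)
          ultimately show "xstar \<bullet> (\<Sum>i<n. \<xi> i) \<le> norm xstar * \<beta> * real n"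
            by (simp add: inner_diff_right mult.assoc)
        qed
        also have "\<dots> \<le> q n"
          unfolding q_def using B sets_eq_imp_space_eq[OF sets_eq]
          by (intro P.finite_measure_mono) (auto simp: A_def)
        finally show ?case .
      qed
    qed
    then show "(\<lambda>n. \<P>(S in random_walk_law \<mu> x. exit_time K S > enat n) powr (1 / real n))
        \<longlonglongrightarrow> enn2real (laplace_transform \<mu> xstar)"
      unfolding q_def L_def prob_exit_time_greater[OF assms(5,6,1)] .
  qed
qed

end
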